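(* In the Bayesian $k$-armed bandit problem described in the context, suppose the prior $\Gamma$ is $1$-regular with constants $0<c_0<C_0$ (i.e. $c_0\epsilon\le\mathbb{P}_\Gamma(\mu>1-\epsilon)\le\mathbb{P}_\Gamma(\mu\ge1-\epsilon)\le C_0\epsilon$ for all $\epsilon\in(0,1]$) and every $P_\mu$ is $1$-subgaussian. Then the subsampled UCB algorithm run with $m=\lceil\sqrt T\rceil$ satisfies $$BR_{T,k}(\text{SS-UCB})\le 2+\sqrt T\Bigl[\frac{\log T}{c_0}+\frac{C_0\log^2T}{c_0^2}+C_0(20+36\log f(T))\bigl(5+\log(\sqrt T c_0)-\log\log T\bigr)\Bigr].$$
   Context: Bayesian $k$-armed bandit: horizon $T$, arms $[k]$, family $\{P_\mu:\mu\in[0,1]\}$ with $P_\mu$ of mean $\mu$; prior $\Gamma$ on $[0,1]$ with density; means i.i.d. $\sim\Gamma$; pulling arm $i$ at time $t$ gives $Y_{it}\sim P_{\mu_i}$ independently, only the pulled reward observed. $R_T(\pi\mid\bm\mu)=T\max_i\mu_i-\sum_{t}\mathbb{E}[\mu_{a_t}\mid\pi]$, $BR_{T,k}(\pi)=\mathbb{E}[R_T(\pi\mid\bm\mu)]$. $1$-subgaussian: $\mathbb{E}[e^{s(Z-\mu)}]\le e^{s^2/2}$ for $Z\sim P_\mu$, all real $s$. $N_i(t)$ = number of pulls of arm $i$ up to $t$, $\hat\mu_i(t)$ = empirical mean of its rewards (equal to $1$ if $N_i(t)=0$), $f(t)=1+t\log^2 t$. UCB on an arm set: pull each arm once, then pull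 $\arg\max_i[\hat\mu_i(t-1)+\sqrt{2\log f(t)/N_i(t-1)}]$. SS-UCB with parameter $m$: draw $m$ arms uniformly at random without replacement from $[k]$ and run UCB on them only. *)

theory Defs
  imports "HOL-Probability.Probability"
begin

text \<open>Arms are 0,...,k-1, time steps are 1,...,T. A reward table Y assigns to
  (arm i, time t) the reward Y(i,t) that is observed if arm i is pulled at time t.\<close>

definition f_conf :: "nat \<Rightarrow> real" where
  "f_conf t = 1 + real t * (ln (real t))^2"

text \<open>A history h lists the arms pulled at times 1,...,length h.\<close>

definition pulls :: "nat list \<Rightarrow> nat \<Rightarrow> nat" where
  "pulls h i = count_list h i"

definition reward_sum :: "nat list \<Rightarrow> (nat \<times> nat \<Rightarrow> real) \<Rightarrow> nat \<Rightarrow> real" where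
  "reward_sum h Y i = (\<Sum>s<length h. if h ! s = i then Y (i, Suc s) else 0)"

definition emp_mean :: "nat list \<Rightarrow> (nat \<times> nat \<Rightarrow> real) \<Rightarrow> nat \<Rightarrow> real" where
  "emp_mean h Y i = (if pulls h i = 0 then 1 else reward_sum h Y i / real (pulls h i))"

definition ucb_index :: "nat list \<Rightarrow> (nat \<times> nat \<Rightarrow> real) \<Rightarrow> nat \<Rightarrow> nat \<Rightarrow> real" where
  "ucb_index h Y t i = emp_mean h Y i + sqrt (2 * ln (f_conf t) / real (pulls h i))"

definition ucb_choose :: "nat list \<Rightarrow> (nat \<times> nat \<Rightarrow> real) \<Rightarrow> nat list \<Rightarrow> nat \<Rightarrow> nat" where
  "ucb_choose arms Y h t =
     (if t \<le> length arms then arms ! (t - 1)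
      else hd (filter (\<lambda>i. ucb_index h Y t i = Max ((ucb_index h Y t) ` set arms)) arms))"

fun ucb_hist :: "nat list \<Rightarrow> (nat \<times> nat \<Rightarrow> real) \<Rightarrow> nat \<Rightarrow> nat list" where
  "ucb_hist arms Y 0 = []"
| "ucb_hist arms Y (Suc n) = (let h = ucb_hist arms Y n in h @ [ucb_choose arms Y h (Suc n)])"

definition reward_table :: "(real \<Rightarrow> real measure) \<Rightarrow> (nat \<Rightarrow> real) \<Rightarrow> nat \<Rightarrow> nat \<Rightarrow> (nat \<times> nat \<Rightarrow> real) measure" where
  "reward_table P mu k T = PiM ({0..<k} \<times> {1..T}) (\<lambda>(i, t). P (mu i))"

definition subsample :: "nat \<Rightarrow> nat \<Rightarrow> nat set pmf" where
  "subsample k m = pmf_of_set {S. S \<subseteq> {0..<k} \<and> card S = m}"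

definition ss_ucb_regret :: "(real \<Rightarrow> real measure) \<Rightarrow> nat \<Rightarrow> nat \<Rightarrow> nat \<Rightarrow> (nat \<Rightarrow> real) \<Rightarrow> real" where
  "ss_ucb_regret P k T m mu =
     real T * Max (mu ` {0..<k})
     - (\<Sum>t\<in>{1..T}. measure_pmf.expectation (subsample k m)
          (\<lambda>S. \<integral>Y. mu (ucb_hist (sorted_list_of_set S) Y T ! (t - 1)) \<partial>reward_table P mu k T))"

definition ss_ucb_BR :: "(real \<Rightarrow> real measure) \<Rightarrow> real measure \<Rightarrow> nat \<Rightarrow> nat \<Rightarrow> nat \<Rightarrow> real" where
  "ss_ucb_BR P \<Gamma> k T m = (\<integral>mu. ss_ucb_regret P k T m mu \<partial>PiM {0..<k} (\<lambda>_. \<Gamma>))"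

definition subgaussian1 :: "real measure \<Rightarrow> real \<Rightarrow> bool" where
  "subgaussian1 M mu \<longleftrightarrow> (\<forall>s::real. integrable M (\<lambda>z. exp (s * (z - mu))) \<and>
       (\<integral>z. exp (s * (z - mu)) \<partial>M) \<le> exp (s^2 / 2))"

definition one_regular :: "real measure \<Rightarrow> real \<Rightarrow> real \<Rightarrow> bool" where
  "one_regular \<Gamma> c0 C0 \<longleftrightarrow> 0 < c0 \<and> c0 < C0 \<and>
     (\<forall>\<epsilon>\<in>{0<..1::real}.
        c0 * \<epsilon> \<le> measure \<Gamma> {x. 1 - \<epsilon> < x} \<and>
        measure \<Gamma> {x. 1 - \<epsilon> < x} \<le> measure \<Gamma> {x. 1 - \<epsilon> \<le> x} \<and>
        measure \<Gamma> {x. 1 - \<epsilon> \<le> x} \<le> C0 * \<epsilon>)"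

end

theory Submission
  imports Defs
begin

text \<open>
  Let \<open>L = ln T\<close> and \<open>\<theta> = L / (c0 * sqrt T)\<close>, and measure all losses against the value \<open>1\<close>.
  If \<open>T = 2\<close> or \<open>2 * \<theta> \<ge> 1\<close>, the trivial bound \<open>T\<close> on the regret suffices. Otherwise some sampled arm has mean
  above \<open>1 - \<theta>\<close> except with probability at most \<open>(1 - c0 * \<theta>) ^ m \<le> 1 / T\<close>. Sampled arms with mean
  at least \<open>1 - 2 * \<theta>\<close> lose at most \<open>2 * \<theta>\<close> per pull, hence \<open>2 * \<theta> * T\<close> in total. An arm with mean
  \<open>1 - x\<close>, \<open>x > 2 * \<theta>\<close>, has gap at least \<open>D = x - \<theta>\<close> to the good arm and is pulled at most
  \<open>(20 + 18 * ln (f T)) / D\<^sup>2\<close> times in expectation; averaging \<open>x / (x - \<theta>)\<^sup>2\<close> over the prior, by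
  writing this decreasing function as the integral of its derivative, gives
  \<open>C0 * (5 + ln (1 / \<theta>))\<close>.

  The pull count rests on one exponential supermartingale inequality at a fixed time. With
  thresholds at thirds of the gap, the suboptimal arm exceeds its threshold at a fixed time with
  probability at most \<open>1 / f T\<close>, so that a union bound over all times costs only a constant.
\<close>

section \<open>Histories and pull counts\<close>

lemma length_ucb_hist [simp]: "length (ucb_hist arms Y n) = n"
  by (induction n) (auto simp: Let_def)

lemma reward_sum_snoc:
  "reward_sum (h @ [a]) Y i = reward_sum h Y i + (if a = i then Y (i, Suc (length h)) else 0)"
proof -
  have "(\<Sum>s<length h. if (h @ [a]) ! s = i then Y (i, Suc s) else 0)
      = (\<Sum>s<length h. if h ! s = i then Y (i, Suc s) else 0)"
    by (intro sum.cong) (auto simp: nth_append)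
  then show ?thesis
    by (simp add: reward_sum_def)
qed

lemma pulls_snoc: "pulls (h @ [a]) i = pulls h i + (if a = i then 1 else 0)"
  by (simp add: pulls_def)

lemma reward_sum_cong:
  assumes "\<And>s. s \<le> length h \<Longrightarrow> Y (i, s) = Y' (i, s)"
  shows "reward_sum h Y i = reward_sum h Y' i"
  unfolding reward_sum_def using assms by (intro sum.cong) auto

lemma ucb_choose_cong:
  assumes "\<And>i s. s \<le> length h \<Longrightarrow> Y (i, s) = Y' (i, s)"
  shows "ucb_choose arms Y h t = ucb_choose arms Y' h t"
proof -
  have "ucb_index h Y t = ucb_index h Y' t"
    unfolding ucb_index_def emp_mean_def using reward_sum_cong[of h Y _ Y'] assms by auto
  then show ?thesis by (simp add: ucb_choose_def)
qed

text \<open>Each choice reads only rewards of earlier steps, so later table entries can be altered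
  without changing the history. This independence of future rewards drives the supermartingale
  step.\<close>

lemma ucb_hist_cong:
  assumes "\<And>i s. s \<le> n \<Longrightarrow> Y (i, s) = Y' (i, s)"
  shows "ucb_hist arms Y n = ucb_hist arms Y' n"
  using assms
proof (induction n)
  case (Suc n)
  then have "ucb_hist arms Y n = ucb_hist arms Y' n" by simp
  moreover have "ucb_choose arms Y h t = ucb_choose arms Y' h t" if "length h = n" for h t
    using Suc.prems that by (intro ucb_choose_cong) auto
  ultimately show ?case by (simp add: Let_def)
qed auto

lemma ucb_hist_nth:
  "s < n \<Longrightarrow> ucb_hist arms Y n ! s = ucb_choose arms Y (ucb_hist arms Y s) (Suc s)"
  by (induction n) (auto simp: Let_def nth_append less_Suc_eq)

lemma ucb_choose_maximal:
  assumes "arms \<noteq> []" "t > length arms"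
  shows "ucb_choose arms Y h t \<in> set arms"
    and "j \<in> set arms \<Longrightarrow> ucb_index h Y t j \<le> ucb_index h Y t (ucb_choose arms Y h t)"
proof -
  let ?p = "\<lambda>i. ucb_index h Y t i = Max ((ucb_index h Y t) ` set arms)"
  have "Max ((ucb_index h Y t) ` set arms) \<in> (ucb_index h Y t) ` set arms"
    using assms by (intro Max_in) auto
  then have "filter ?p arms \<noteq> []" by (auto simp: filter_empty_conv)
  then have "hd (filter ?p arms) \<in> set (filter ?p arms)" by (rule hd_in_set)
  moreover have "ucb_choose arms Y h t = hd (filter ?p arms)"
    using assms by (simp add: ucb_choose_def)
  ultimately have *: "ucb_choose arms Y h t \<in> set arms" "?p (ucb_choose arms Y h t)" by auto
  from * show "ucb_choose arms Y h t \<in> set arms" by simp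
  from * show "j \<in> set arms \<Longrightarrow> ucb_index h Y t j \<le> ucb_index h Y t (ucb_choose arms Y h t)" by auto
qed

lemma ucb_choose_in_arms:
  assumes "arms \<noteq> []" "t \<ge> 1"
  shows "ucb_choose arms Y h t \<in> set arms"
proof (cases "t \<le> length arms")
  case True
  then show ?thesis using assms by (simp add: ucb_choose_def)
next
  case False
  then show ?thesis using ucb_choose_maximal(1) assms by simp
qed

lemma ucb_hist_in_arms:
  "arms \<noteq> [] \<Longrightarrow> set (ucb_hist arms Y n) \<subseteq> set arms"
  by (induction n) (auto simp: Let_def ucb_choose_in_arms)

lemma ucb_hist_initial: "n \<le> length arms \<Longrightarrow> ucb_hist arms Y n = take n arms"
  by (induction n) (auto simp: Let_def ucb_choose_def take_Suc_conv_app_nth)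

lemma pulls_mono: "n \<le> n' \<Longrightarrow> pulls (ucb_hist arms Y n) i \<le> pulls (ucb_hist arms Y n') i"
  by (induction n' rule: dec_induct) (auto simp: Let_def pulls_snoc)

lemma pulls_pos:
  assumes "i \<in> set arms" "length arms \<le> n"
  shows "pulls (ucb_hist arms Y n) i > 0"
proof -
  have "pulls (ucb_hist arms Y (length arms)) i > 0"
    using assms(1) by (simp add: ucb_hist_initial pulls_def count_list_0_iff zero_less_iff_neq_zero)
  with pulls_mono[OF assms(2)] show ?thesis by (meson less_le_trans)
qed

lemma pulls_le_length: "pulls h i \<le> length h"
  by (simp add: pulls_def count_le_length)

text \<open>Regret decomposition: a sum over time steps is regrouped by the arm pulled. It serves
  with \<open>g\<close> the loss of an arm and with \<open>g\<close> constantly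
  \<open>1\<close>.\<close>

lemma sum_pulls:
  assumes "finite A" "set h \<subseteq> A"
  shows "(\<Sum>i\<in>A. real (pulls h i) * g i) = (\<Sum>s<length h. g (h ! s) :: real)"
  using assms(2)
proof (induction h rule: rev_induct)
  case (snoc a h)
  have "(\<Sum>i\<in>A. real (pulls (h @ [a]) i) * g i)
      = (\<Sum>i\<in>A. real (pulls h i) * g i + (if i = a then g i else 0))"
    by (intro sum.cong) (auto simp: pulls_snoc algebra_simps)
  also have "\<dots> = (\<Sum>s<length h. g (h ! s)) + g a"
    using snoc assms(1) by (simp add: sum.distrib)
  also have "(\<Sum>s<length h. g (h ! s)) = (\<Sum>s<length h. g ((h @ [a]) ! s))"
    by (intro sum.cong) (auto simp: nth_append)
  finally show ?case by simp
qed (simp add: pulls_def)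

lemma f_conf_ge_1: "f_conf t \<ge> 1"
  by (simp add: f_conf_def)

lemma f_conf_mono: "1 \<le> s \<Longrightarrow> s \<le> t \<Longrightarrow> f_conf s \<le> f_conf t"
  unfolding f_conf_def by (intro add_mono mult_mono power_mono) auto

text \<open>Only pulls made once the arm has at least \<open>w\<close> pulls are counted by the sum;
  the earlier ones bring its count to at most \<open>w + 1\<close>. The sum starts after the initial
  round, which pulls each arm at most once.\<close>

lemma pulls_le_count:
  assumes arms: "distinct arms" "arms \<noteq> []" and w: "w \<ge> 0" and n: "length arms \<le> n"
  shows "real (pulls (ucb_hist arms Y n) i) \<le> w + 1 +
    (\<Sum>s=length arms..<n. of_bool (ucb_hist arms Y n ! s = i \<and> w \<le> real (pulls (ucb_hist arms Y s) i)))"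
  using n
proof (induction n rule: dec_induct)
  case base
  have "count_list arms i \<le> 1"
    using arms(1) by (induction arms) auto
  then show ?case using w by (simp add: ucb_hist_initial pulls_def)
next
  case (step n)
  let ?c = "ucb_choose arms Y (ucb_hist arms Y n) (Suc n)"
  have *: "(\<Sum>s=length arms..<Suc n. of_bool (ucb_hist arms Y (Suc n) ! s = i \<and> w \<le> real (pulls (ucb_hist arms Y s) i)))
     = (\<Sum>s=length arms..<n. of_bool (ucb_hist arms Y n ! s = i \<and> w \<le> real (pulls (ucb_hist arms Y s) i)))
       + (of_bool (?c = i \<and> w \<le> real (pulls (ucb_hist arms Y n) i)) :: real)"
    using step.hyps
    by (subst sum.atLeastLessThan_Suc) (auto simp del: ucb_hist.simps simp: ucb_hist_nth intro!: sum.cong)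
  have **: "real (pulls (ucb_hist arms Y (Suc n)) i) = real (pulls (ucb_hist arms Y n) i) + of_bool (?c = i)"
    by (simp add: Let_def pulls_snoc)
  have nn: "(0::real) \<le> (\<Sum>s=length arms..<n. of_bool (ucb_hist arms Y n ! s = i \<and> w \<le> real (pulls (ucb_hist arms Y s) i)))"
    by (intro sum_nonneg) auto
  \<comment> \<open>A pull of arm \<open>i\<close> made while its count is below \<open>w\<close>
    leaves the count below \<open>w + 1\<close>, whatever the sum is.\<close>
  show ?case
    unfolding * ** using step.IH w nn by (auto simp: of_bool_def split: if_splits)
qed

section \<open>Concentration for adaptively sampled arms\<close>

lemma measurable_hd_filter:
  assumes "\<And>i. i \<in> set xs \<Longrightarrow> Measurable.pred M (\<lambda>x. p x i)"
  shows "(\<lambda>x. hd (filter (p x) xs)) \<in> M \<rightarrow>\<^sub>M count_space UNIV"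
  using assms
proof (induction xs)
  case (Cons a xs)
  then have [measurable]: "(\<lambda>x. hd (filter (p x) xs)) \<in> M \<rightarrow>\<^sub>M count_space UNIV"
    "Measurable.pred M (\<lambda>x. p x a)" by auto
  have "(\<lambda>x. hd (filter (p x) (a # xs))) = (\<lambda>x. if p x a then a else hd (filter (p x) xs))"
    by auto
  then show ?case by simp
qed auto

text \<open>The laws \<open>R i\<close> are probability measures for every natural \<open>i\<close>,
  since the product locale asks this of all indices; the subgaussian bound concerns real arms
  only.\<close>

locale subgaussian_ucb =
  fixes R :: "nat \<Rightarrow> real measure" and mu :: "nat \<Rightarrow> real" and k T :: nat and arms :: "nat list"
  assumes prob_R: "\<And>i. prob_space (R i)"
    and sets_R: "\<And>i. sets (R i) = sets borel"
    and subg: "\<And>i. i < k \<Longrightarrow> subgaussian1 (R i) (mu i)"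
    and arms_lt: "set arms \<subseteq> {0..<k}"
    and distinct_arms: "distinct arms"
    and arms_ne: "arms \<noteq> []"
begin

abbreviation "rewards \<equiv> PiM ({0..<k} \<times> {Suc 0..T}) (\<lambda>(i, t). R i)"
abbreviation "hist Y n \<equiv> ucb_hist arms Y n"

sublocale product_prob_space "\<lambda>(i::nat, t::nat). R i" "{0..<k} \<times> {Suc 0..T}"
  by (intro product_prob_spaceI) (auto simp: prob_R)

lemma measurable_reward:
  assumes "i < k" "1 \<le> s" "s \<le> T"
  shows "(\<lambda>Y. Y (i, s)) \<in> borel_measurable rewards"
proof -
  have "(\<lambda>Y. Y (i, s)) \<in> measurable rewards ((\<lambda>(i, t). R i) (i, s))"
    using assms by (intro measurable_component_singleton) auto
  then show ?thesis
    by (simp add: measurable_cong_sets[OF refl sets_R])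
qed

lemma measurable_reward_sum:
  assumes "i < k" "length h \<le> T"
  shows "(\<lambda>Y. reward_sum h Y i) \<in> borel_measurable rewards"
proof -
  have "(\<lambda>Y. if h ! s = i then Y (i, Suc s) else 0) \<in> borel_measurable rewards" if "s < length h" for s
    using measurable_reward[of i "Suc s"] that assms by (cases "h ! s = i") auto
  then show ?thesis unfolding reward_sum_def by (intro borel_measurable_sum) auto
qed

lemma measurable_ucb_index:
  assumes "i < k" "length h \<le> T"
  shows "(\<lambda>Y. ucb_index h Y t i) \<in> borel_measurable rewards"
  using measurable_reward_sum[OF assms] unfolding ucb_index_def emp_mean_def by measurable

lemma measurable_ucb_choose:
  assumes "length h \<le> T"
  shows "(\<lambda>Y. ucb_choose arms Y h t) \<in> rewards \<rightarrow>\<^sub>M count_space UNIV"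
proof (cases "t \<le> length arms")
  case False
  have "(\<lambda>Y. ucb_index h Y t i) \<in> borel_measurable rewards" if "i \<in> set arms" for i
    using that arms_lt assms by (intro measurable_ucb_index) auto
  note idx = this
  have le: "Measurable.pred rewards (\<lambda>Y. \<forall>j\<in>set arms. ucb_index h Y t j \<le> ucb_index h Y t i)"
    if "i \<in> set arms" for i
  proof (rule pred_intros_finite)
    fix j assume "j \<in> set arms"
    then show "Measurable.pred rewards (\<lambda>Y. ucb_index h Y t j \<le> ucb_index h Y t i)"
      unfolding Measurable.pred_def using idx that by (intro borel_measurable_le) auto
  qed simp
  \<comment> \<open>Attaining the maximum becomes finitely many pairwise comparisons of measurable
    indices.\<close>
  have "(ucb_index h Y t i = Max (ucb_index h Y t ` set arms)) \<longleftrightarrow>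
      (\<forall>j\<in>set arms. ucb_index h Y t j \<le> ucb_index h Y t i)" if "i \<in> set arms" for Y i
    using that arms_ne by (auto intro!: Max_eqI[symmetric])
  then have *: "filter (\<lambda>i. ucb_index h Y t i = Max (ucb_index h Y t ` set arms)) arms
     = filter (\<lambda>i. \<forall>j\<in>set arms. ucb_index h Y t j \<le> ucb_index h Y t i) arms" for Y
    by (intro filter_cong) auto
  show ?thesis
    using False le by (simp add: ucb_choose_def * measurable_hd_filter)
qed (simp add: ucb_choose_def)

lemma measurable_hist:
  "n \<le> T \<Longrightarrow> (\<lambda>Y. hist Y n) \<in> rewards \<rightarrow>\<^sub>M count_space UNIV"
proof (induction n)
  case (Suc n)
  \<comment> \<open>Splitting over the countably many histories requires \<open>F h\<close> to be
    measurable for every list \<open>h\<close>; lists of the wrong length get the default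
    \<open>[]\<close>.\<close>
  define F where "F h Y = (if length h = n then h @ [ucb_choose arms Y h (Suc n)] else [])" for h Y
  have F: "F h \<in> rewards \<rightarrow>\<^sub>M count_space UNIV" for h
  proof (cases "length h = n")
    case True
    then have "(\<lambda>Y. ucb_choose arms Y h (Suc n)) \<in> rewards \<rightarrow>\<^sub>M count_space UNIV"
      using Suc.prems by (intro measurable_ucb_choose) auto
    then have "(\<lambda>Y. h @ [ucb_choose arms Y h (Suc n)]) \<in> rewards \<rightarrow>\<^sub>M count_space UNIV"
      by (rule measurable_compose) simp
    then show ?thesis
      using True by (simp add: F_def[abs_def])
  qed (simp add: F_def[abs_def])
  have "(\<lambda>Y. F (hist Y n) Y) \<in> rewards \<rightarrow>\<^sub>M count_space UNIV"
    by (rule measurable_compose_countable[where f = F, OF F]) (use Suc in auto)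
  then show ?case by (simp add: F_def Let_def)
qed simp

text \<open>Histories live in a countable discrete space, so measurability for each fixed history
  passes to the random one. Lists of the wrong length are sent to a constant of
  \<open>N\<close>.\<close>

lemma measurable_hist_fun:
  assumes "n \<le> T" "\<And>h. length h = n \<Longrightarrow> F h \<in> rewards \<rightarrow>\<^sub>M N" "space N \<noteq> {}"
  shows "(\<lambda>Y. F (hist Y n) Y) \<in> rewards \<rightarrow>\<^sub>M N"
proof -
  obtain c where c: "c \<in> space N" using assms(3) by auto
  define G where "G h = (if length h = n then F h else (\<lambda>_. c))" for h
  have "G h \<in> rewards \<rightarrow>\<^sub>M N" for h
    using assms(2) c by (auto simp: G_def)
  then have "(\<lambda>Y. G (hist Y n) Y) \<in> rewards \<rightarrow>\<^sub>M N"
    by (rule measurable_compose_countable) (rule measurable_hist[OF assms(1)])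
  then show ?thesis by (simp add: G_def)
qed

text \<open>The logarithm of the supermartingale: each observed reward of arm \<open>i\<close> contributes
  \<open>l * (reward - mu i) - l\<^sup>2 / 2\<close>.\<close>

definition log_mart :: "real \<Rightarrow> nat \<Rightarrow> nat list \<Rightarrow> (nat \<times> nat \<Rightarrow> real) \<Rightarrow> real" where
  "log_mart l i h Y = l * (reward_sum h Y i - mu i * real (pulls h i)) - l\<^sup>2 / 2 * real (pulls h i)"

lemma measurable_log_mart:
  assumes "i < k" "n \<le> T"
  shows "(\<lambda>Y. log_mart l i (hist Y n) Y) \<in> borel_measurable rewards"
proof (rule measurable_hist_fun)
  fix h :: "nat list" assume "length h = n"
  then have [measurable]: "(\<lambda>Y. reward_sum h Y i) \<in> borel_measurable rewards"
    using measurable_reward_sum assms by simp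
  show "log_mart l i h \<in> borel_measurable rewards"
    unfolding log_mart_def[abs_def] by measurable
qed (use assms in auto)

lemma measurable_exp_log_mart:
  assumes "i < k" "n \<le> T"
  shows "(\<lambda>Y. ennreal (exp (log_mart l i (hist Y n) Y))) \<in> borel_measurable rewards"
  by (rule measurable_compose[OF measurable_log_mart[OF assms]]) measurable

text \<open>One-step factor of the supermartingale: dividing the moment generating function by its
  subgaussian bound leaves mean at most one.\<close>

lemma nn_integral_subgaussian:
  assumes "i < k"
  shows "(\<integral>\<^sup>+y. ennreal (exp (l * (y - mu i) - l\<^sup>2 / 2)) \<partial>R i) \<le> 1"
proof -
  have "integrable (R i) (\<lambda>y. exp (l * (y - mu i)))" "(\<integral>y. exp (l * (y - mu i)) \<partial>R i) \<le> exp (l\<^sup>2 / 2)"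
    using subg[OF assms] by (auto simp: subgaussian1_def)
  then have "(\<integral>\<^sup>+y. ennreal (exp (l * (y - mu i))) \<partial>R i) \<le> ennreal (exp (l\<^sup>2 / 2))"
    by (subst nn_integral_eq_integral) (auto intro: ennreal_leI)
  then have "(\<integral>\<^sup>+y. ennreal (exp (l * (y - mu i))) \<partial>R i) * ennreal (exp (- (l\<^sup>2 / 2)))
     \<le> ennreal (exp (l\<^sup>2 / 2)) * ennreal (exp (- (l\<^sup>2 / 2)))"
    by (rule mult_right_mono) simp
  also have "\<dots> = 1" by (simp add: ennreal_mult[symmetric] exp_minus_inverse)
  also have "(\<integral>\<^sup>+y. ennreal (exp (l * (y - mu i))) \<partial>R i) * ennreal (exp (- (l\<^sup>2 / 2)))
      = (\<integral>\<^sup>+y. ennreal (exp (l * (y - mu i) - l\<^sup>2 / 2)) \<partial>R i)"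
    by (subst nn_integral_multc[symmetric])
       (auto simp: ennreal_mult[symmetric] exp_add[symmetric] measurable_cong_sets[OF sets_R refl])
  finally show ?thesis .
qed

text \<open>The history of length \<open>n\<close> ignores the table entry of arm \<open>i\<close> at time \<open>n + 1\<close>, so this entry
  can be integrated out first.\<close>

lemma nn_integral_exp_log_mart:
  assumes i: "i < k" and n: "n \<le> T"
  shows "(\<integral>\<^sup>+Y. ennreal (exp (log_mart l i (hist Y n) Y)) \<partial>rewards) \<le> 1"
  using n
proof (induction n)
  case 0
  then show ?case
    using P.emeasure_space_1 by (simp add: log_mart_def pulls_def reward_sum_def)
next
  case (Suc n)
  let ?M = "\<lambda>(i::nat, t::nat). R i"
  define j where "j = (i, Suc n)"
  define J where "J = {0..<k} \<times> {Suc 0..T} - {j}"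
  have J: "{0..<k} \<times> {Suc 0..T} = insert j J" "finite J" "j \<notin> J"
    using i Suc.prems by (auto simp: J_def j_def)
  let ?W = "\<lambda>n Y. ennreal (exp (log_mart l i (hist Y n) Y))"
  have meas: "?W n \<in> borel_measurable (PiM (insert j J) ?M)" if "n \<le> T" for n
    using measurable_exp_log_mart[OF i that, of l] unfolding J(1)[symmetric] .
  have upd: "hist (Y(j := y)) n = hist Y n" "reward_sum (hist Y n) (Y(j := y)) i = reward_sum (hist Y n) Y i"
    for Y y
    by (auto intro!: ucb_hist_cong reward_sum_cong simp: j_def)
  have upd_j: "(Y(j := y)) (i, Suc n) = y" for Y and y :: real
    by (simp add: j_def)
  have W_upd: "?W n (Y(j := y)) = ?W n Y" for Y y
    by (simp add: log_mart_def upd)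
  have step: "(\<integral>\<^sup>+y. ?W (Suc n) (Y(j := y)) \<partial>R i) \<le> ?W n Y" for Y
  proof -
    \<comment> \<open>The choice at time \<open>n + 1\<close> does not see entry \<open>j\<close>.
      The weight is thus multiplied by the one-step factor if \<open>a = i\<close> and by
      \<open>1\<close> otherwise.\<close>
    define a where "a = ucb_choose arms Y (hist Y n) (Suc n)"
    have a: "ucb_choose arms (Y(j := y)) (hist Y n) (Suc n) = a" for y
      unfolding a_def by (intro ucb_choose_cong) (auto simp: j_def)
    have "log_mart l i (hist (Y(j := y)) (Suc n)) (Y(j := y)) =
        log_mart l i (hist Y n) Y + (if a = i then l * (y - mu i) - l\<^sup>2 / 2 else 0)" for y
      by (simp add: Let_def log_mart_def upd upd_j a reward_sum_snoc pulls_snoc algebra_simps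
          del: fun_upd_apply)
    then have "?W (Suc n) (Y(j := y)) =
        ?W n Y * (if a = i then ennreal (exp (l * (y - mu i) - l\<^sup>2 / 2)) else 1)" for y
      by (simp only:) (simp add: exp_add ennreal_mult)
    then have "(\<integral>\<^sup>+y. ?W (Suc n) (Y(j := y)) \<partial>R i) =
        ?W n Y * (\<integral>\<^sup>+y. (if a = i then ennreal (exp (l * (y - mu i) - l\<^sup>2 / 2)) else 1) \<partial>R i)"
      by (simp add: nn_integral_cmult measurable_cong_sets[OF sets_R refl])
    also have "\<dots> \<le> ?W n Y * 1"
      using nn_integral_subgaussian[OF i, of l] prob_space.emeasure_space_1[OF prob_R, of i]
      by (intro mult_left_mono) (cases "a = i"; simp)+
    finally show ?thesis by simp
  qed
  have "(\<integral>\<^sup>+Y. ?W (Suc n) Y \<partial>rewards) = (\<integral>\<^sup>+Y. (\<integral>\<^sup>+y. ?W (Suc n) (Y(j := y)) \<partial>R i) \<partial>PiM J ?M)"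
    unfolding J(1) using product_nn_integral_insert[OF J(2,3) meas[OF Suc.prems]]
    by (simp add: j_def)
  also have "\<dots> \<le> (\<integral>\<^sup>+Y. ?W n Y \<partial>PiM J ?M)"
    by (intro nn_integral_mono step)
  \<comment> \<open>\<open>?W n\<close> does not depend on entry \<open>j\<close>, so integrating it
    against the probability measure \<open>R i\<close> restores the full product without changing
    the value.\<close>
  also have "\<dots> = (\<integral>\<^sup>+Y. (\<integral>\<^sup>+y. ?W n (Y(j := y)) \<partial>R i) \<partial>PiM J ?M)"
    by (simp add: W_upd prob_space.emeasure_space_1[OF prob_R])
  also have "\<dots> = (\<integral>\<^sup>+Y. ?W n Y \<partial>rewards)"
    unfolding J(1) using product_nn_integral_insert[OF J(2,3) meas[of n]] Suc.prems
    by (simp add: j_def)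
  also have "\<dots> \<le> 1" using Suc by simp
  finally show ?case .
qed

section \<open>Tail bounds for empirical means at a fixed time\<close>

lemma prob_log_mart_ge:
  assumes i: "i < k" and n: "n \<le> T" and E: "E \<in> sets rewards"
    and ge: "\<And>Y. Y \<in> E \<Longrightarrow> c \<le> log_mart l i (hist Y n) Y"
  shows "measure rewards E \<le> exp (- c)"
proof -
  have "emeasure rewards E = (\<integral>\<^sup>+Y. indicator E Y \<partial>rewards)" using E by simp
  \<comment> \<open>Markov's inequality for the exponential weight.\<close>
  also have "\<dots> \<le> (\<integral>\<^sup>+Y. ennreal (exp (- c)) * ennreal (exp (log_mart l i (hist Y n) Y)) \<partial>rewards)"
  proof (rule nn_integral_mono)
    fix Y
    show "indicator E Y \<le> ennreal (exp (- c)) * ennreal (exp (log_mart l i (hist Y n) Y))"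
      using ge[of Y] by (cases "Y \<in> E") (auto simp flip: ennreal_mult exp_add)
  qed
  also have "\<dots> = ennreal (exp (- c)) * (\<integral>\<^sup>+Y. ennreal (exp (log_mart l i (hist Y n) Y)) \<partial>rewards)"
    using measurable_exp_log_mart[OF i n, of l] by (intro nn_integral_cmult)
  also have "\<dots> \<le> ennreal (exp (- c)) * 1"
    by (intro mult_left_mono nn_integral_exp_log_mart[OF i n]) simp
  finally show ?thesis unfolding P.emeasure_eq_measure by simp
qed

lemma sets_emp_mean:
  assumes "i < k" "n \<le> T" "\<And>u. Measurable.pred borel (p u)"
  shows "{Y \<in> space rewards. p (pulls (hist Y n) i) (emp_mean (hist Y n) Y i)} \<in> sets rewards"
proof -
  have "Measurable.pred rewards (\<lambda>Y. p (pulls (hist Y n) i) (emp_mean (hist Y n) Y i))"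
  proof (rule measurable_hist_fun[OF assms(2)])
    fix h :: "nat list" assume "length h = n"
    then have [measurable]: "(\<lambda>Y. reward_sum h Y i) \<in> borel_measurable rewards"
      using measurable_reward_sum assms by simp
    have "(\<lambda>Y. emp_mean h Y i) \<in> borel_measurable rewards"
      unfolding emp_mean_def by measurable
    then show "Measurable.pred rewards (\<lambda>Y. p (pulls h i) (emp_mean h Y i))"
      by (rule measurable_compose) (rule assms(3))
  qed simp
  then show ?thesis by measurable
qed

text \<open>Chernoff bound with \<open>l = y\<close>: on the event the log-weight is at least
  \<open>y^2 / 2\<close> times the number of pulls. As this grows with the pulls, a single exponent
  covers all counts above \<open>w\<close>.\<close>

lemma prob_overestimate:
  assumes i: "i < k" and n: "n \<le> T" and y: "y \<ge> 0" and w: "w > 0"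
  shows "measure rewards {Y\<in>space rewards. w \<le> real (pulls (hist Y n) i) \<and> mu i + y \<le> emp_mean (hist Y n) Y i}
    \<le> exp (- (y\<^sup>2 * w / 2))" (is "measure _ ?E \<le> _")
proof (rule prob_log_mart_ge[OF i n])
  show "?E \<in> sets rewards"
    by (rule sets_emp_mean[OF i n]) measurable
  fix Y assume "Y \<in> ?E"
  then have Y: "w \<le> real (pulls (hist Y n) i)" "mu i + y \<le> emp_mean (hist Y n) Y i" by auto
  define N where "N = real (pulls (hist Y n) i)"
  have N: "N > 0" "w \<le> N" using Y w by (auto simp: N_def)
  then have "(mu i + y) * N \<le> reward_sum (hist Y n) Y i"
    using Y(2) by (auto simp: emp_mean_def N_def field_simps split: if_splits)
  then have "y * (y * N) \<le> y * (reward_sum (hist Y n) Y i - mu i * N)"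
    using y by (intro mult_left_mono) (auto simp: algebra_simps)
  moreover have "y\<^sup>2 * w \<le> y\<^sup>2 * N"
    using N by (intro mult_left_mono) auto
  ultimately show "y\<^sup>2 * w / 2 \<le> log_mart y i (hist Y n) Y"
    unfolding log_mart_def N_def[symmetric] by (simp add: power2_eq_square algebra_simps)
qed

text \<open>Here the optimal exponent depends on the number of pulls, hence a union over its possible
  values, summed as a geometric series.\<close>

lemma prob_underestimate:
  assumes i: "i < k" and n: "n \<le> T" and e: "e > 0" and b: "b \<ge> 0"
  shows "measure rewards {Y\<in>space rewards. 0 < pulls (hist Y n) i \<and>
            emp_mean (hist Y n) Y i + sqrt (2 * b / real (pulls (hist Y n) i)) < mu i - e}
    \<le> exp (- b) * (2 / e\<^sup>2)" (is "measure _ ?E \<le> _")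
proof -
  define A where "A u = {Y\<in>space rewards. pulls (hist Y n) i = u \<and>
      emp_mean (hist Y n) Y i + sqrt (2 * b / real u) < mu i - e}" for u
  define q where "q = exp (- (e\<^sup>2 / 2))"
  have A_sets: "A u \<in> sets rewards" for u
    unfolding A_def by (rule sets_emp_mean[OF i n]) measurable
  have A_prob: "measure rewards (A u) \<le> exp (- b) * q ^ u" if u: "u > 0" for u
  proof -
    \<comment> \<open>On \<open>A u\<close> the empirical mean is more than \<open>x\<close> below
      \<open>mu i\<close>, and \<open>l = - x\<close> is the best exponent for \<open>u\<close>
      pulls.\<close>
    define x where "x = sqrt (2 * b / real u) + e"
    have x: "x \<ge> 0" using e b by (simp add: x_def)
    have "measure rewards (A u) \<le> exp (- (x\<^sup>2 * real u / 2))"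
    proof (rule prob_log_mart_ge[OF i n A_sets, where l = "- x"])
      fix Y assume "Y \<in> A u"
      then have Y: "pulls (hist Y n) i = u" "emp_mean (hist Y n) Y i + x < mu i"
        by (auto simp: A_def x_def)
      then have "reward_sum (hist Y n) Y i - mu i * real u \<le> - (x * real u)"
        using u by (auto simp: emp_mean_def field_simps)
      then have "x * (x * real u) \<le> x * (- (reward_sum (hist Y n) Y i - mu i * real u))"
        using x by (intro mult_left_mono) auto
      then show "x\<^sup>2 * real u / 2 \<le> log_mart (- x) i (hist Y n) Y"
        unfolding log_mart_def Y(1) by (simp add: power2_eq_square algebra_simps)
    qed
    also have "x\<^sup>2 * real u / 2 \<ge> b + real u * (e\<^sup>2 / 2)"
    proof -
      \<comment> \<open>The cross term of the square is dropped: the confidence width yields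
        \<open>b\<close>, the slack \<open>e\<close> yields the geometric decay in
        \<open>u\<close>.\<close>
      have "x\<^sup>2 \<ge> (sqrt (2 * b / real u))\<^sup>2 + e\<^sup>2"
        using e b unfolding x_def power2_sum by simp
      also have "(sqrt (2 * b / real u))\<^sup>2 = 2 * b / real u" using b by simp
      finally have "(2 * b / real u + e\<^sup>2) * real u \<le> x\<^sup>2 * real u" by (intro mult_right_mono) auto
      moreover have "(2 * b / real u + e\<^sup>2) * real u = 2 * b + e\<^sup>2 * real u"
        using u by (simp add: distrib_right)
      ultimately show ?thesis by (simp add: algebra_simps)
    qed
    then have "exp (- (x\<^sup>2 * real u / 2)) \<le> exp (- (b + real u * (e\<^sup>2 / 2)))" by simp
    also have "\<dots> = exp (- b) * q ^ u"
      unfolding q_def by (simp add: exp_of_nat_mult[symmetric] exp_add[symmetric])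
    finally show ?thesis by simp
  qed
  have q: "0 < q" "q < 1" using e by (auto simp: q_def)
  have "?E \<subseteq> (\<Union>u\<in>{1..n}. A u)"
  proof
    fix Y assume "Y \<in> ?E"
    then have "Y \<in> A (pulls (hist Y n) i)" "pulls (hist Y n) i \<in> {1..n}"
      using pulls_le_length[of "hist Y n" i] by (auto simp: A_def)
    then show "Y \<in> (\<Union>u\<in>{1..n}. A u)" by blast
  qed
  then have "measure rewards ?E \<le> measure rewards (\<Union>u\<in>{1..n}. A u)"
    using A_sets by (intro finite_measure_mono) auto
  also have "\<dots> \<le> (\<Sum>u\<in>{1..n}. measure rewards (A u))"
    using A_sets by (intro finite_measure_subadditive_finite) auto
  also have "\<dots> \<le> (\<Sum>u\<in>{1..n}. exp (- b) * q ^ u)"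
    using A_prob by (intro sum_mono) auto
  also have "\<dots> = exp (- b) * (\<Sum>u\<in>{1..n}. q ^ u)" by (simp add: sum_distrib_left)
  also have "(\<Sum>u\<in>{1..n}. q ^ u) \<le> 2 / e\<^sup>2"
  proof -
    have "(\<Sum>u\<in>{1..n}. q ^ u) = q * (\<Sum>u<n. q ^ u)"
      by (simp add: sum_distrib_left sum.atLeast1_atMost_eq)
    also have "(\<Sum>u<n. q ^ u) = (1 - q ^ n) / (1 - q)"
      using q by (subst sum_gp_strict) auto
    also have "\<dots> \<le> 1 / (1 - q)" using q by (intro divide_right_mono) auto
    finally have "(\<Sum>u\<in>{1..n}. q ^ u) \<le> q / (1 - q)" using q by (simp add: mult_left_mono)
    also have "\<dots> \<le> 2 / e\<^sup>2"
    proof -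
      \<comment> \<open>This gives \<open>q * (1 + e^2 / 2) \<le> 1\<close>, which rearranges to the
        bound on \<open>q / (1 - q)\<close>.\<close>
      have "1 + e\<^sup>2 / 2 \<le> exp (e\<^sup>2 / 2)" by (rule exp_ge_add_one_self)
      then have "q * (1 + e\<^sup>2 / 2) \<le> q * exp (e\<^sup>2 / 2)" using q by (intro mult_left_mono) auto
      also have "\<dots> = 1" by (simp add: q_def exp_minus)
      finally show ?thesis using q e by (simp add: field_simps)
    qed
    finally show ?thesis .
  qed
  finally show ?thesis by (simp add: mult_left_mono)
qed

end

section \<open>Expected number of pulls\<close>

lemma ln_ge_1: "3 \<le> x \<Longrightarrow> 1 \<le> ln (x::real)"
  using exp_le by (subst ln_ge_iff) auto

lemma sum_inverse_f_conf_le: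
  assumes "3 \<le> m"
  shows "(\<Sum>s=m..<n. 1 / f_conf (Suc s)) \<le> 1"
proof (cases "m \<le> n")
  case True
  txt \<open>The terms are dominated by a telescoping series, as \<open>1 / (s + 1) \<le> ln (s + 1) - ln s\<close>.\<close>
  have step: "1 / f_conf (Suc s) \<le> 1 / ln (real s) - 1 / ln (real (Suc s))" if "3 \<le> s" for s
  proof -
    define a b where "a = ln (real s)" and "b = ln (real (Suc s))"
    have a: "1 \<le> a" using that ln_ge_1[of "real s"] by (simp add: a_def)
    have ab: "a \<le> b" using that unfolding a_def b_def by (subst ln_le_cancel_iff) auto
    have "1 / real (Suc s) \<le> b - a"
    proof -
      have "ln (real s / real (Suc s)) \<le> real s / real (Suc s) - 1"
        using that by (intro ln_le_minus_one) auto
      then show ?thesis using that by (simp add: a_def b_def ln_div field_simps)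
    qed
    \<comment> \<open>Multiplied by \<open>b^2\<close>, this shows that
      \<open>f_conf (Suc s) * (b - a)\<close> is at least \<open>b^2\<close>, hence at least
      \<open>a * b\<close>.\<close>
    then have "1 \<le> real (Suc s) * (b - a)" by (simp add: field_simps)
    then have "b * b * 1 \<le> b * b * (real (Suc s) * (b - a))"
      using a ab by (intro mult_left_mono) auto
    moreover have "a * b \<le> b * b" using a ab by (intro mult_right_mono) auto
    moreover have "0 \<le> b - a" using ab by simp
    ultimately have "a * b \<le> (1 + real (Suc s) * b\<^sup>2) * (b - a)"
      by (simp add: algebra_simps power2_eq_square)
    moreover have "0 < 1 + real (Suc s) * b\<^sup>2" by (simp add: add_pos_nonneg)
    ultimately have "1 / (1 + real (Suc s) * b\<^sup>2) \<le> (b - a) / (a * b)"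
      using a ab by (simp add: divide_simps mult_ac)
    also have "\<dots> = 1 / a - 1 / b" using a ab by (simp add: field_simps)
    finally show ?thesis by (simp only: f_conf_def a_def b_def)
  qed
  have "(\<Sum>s=m..<n. 1 / f_conf (Suc s)) \<le> (\<Sum>s=m..<n. 1 / ln (real s) - 1 / ln (real (Suc s)))"
    using assms by (intro sum_mono step) auto
  also have "\<dots> = 1 / ln (real m) - 1 / ln (real n)"
    using sum_Suc_diff'[OF True, of "\<lambda>s. - (1 / ln (real s))"] by simp
  also have "\<dots> \<le> 1 / 1 - 0"
    using ln_ge_1[of "real m"] assms True by (intro diff_mono divide_left_mono) auto
  finally show ?thesis by simp
qed simp

text \<open>Loss per pull of an arm with mean \<open>x\<close> times the inverse squared gap to an
  arm of value \<open>1 - th\<close>. Arms within \<open>2 * th\<close> of the top are charged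
  separately; the cut-off \<open>0 \<le> x\<close> keeps \<open>1 - x\<close> in the range where
  regularity bounds the tail.\<close>

definition gap_cost :: "real \<Rightarrow> real \<Rightarrow> real" where
  "gap_cost th x = (if 0 \<le> x \<and> 2 * th < 1 - x then (1 - x) / (1 - x - th)\<^sup>2 else 0)"

lemma gap_cost_nonneg: "0 \<le> th \<Longrightarrow> 0 \<le> gap_cost th x"
  by (simp add: gap_cost_def)

context subgaussian_ucb begin

lemma integrable_hist:
  fixes g :: "nat list \<Rightarrow> real"
  assumes "n \<le> T" "\<And>h. length h = n \<Longrightarrow> set h \<subseteq> set arms \<Longrightarrow> \<bar>g h\<bar> \<le> B"
  shows "integrable rewards (\<lambda>Y. g (hist Y n))"
proof (rule P.integrable_const_bound)
  show "AE Y in rewards. norm (g (hist Y n)) \<le> B"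
    using assms(2) ucb_hist_in_arms[OF arms_ne] by (intro AE_I2) simp
  show "(\<lambda>Y. g (hist Y n)) \<in> borel_measurable rewards"
    by (rule measurable_compose[OF measurable_hist[OF assms(1)]]) simp
qed

lemma integrable_pulls: "n \<le> T \<Longrightarrow> integrable rewards (\<lambda>Y. real (pulls (hist Y n) i))"
  by (rule integrable_hist[where B = "real n"]) (auto intro: pulls_le_length)

text \<open>Choosing \<open>i\<close> after \<open>w\<close> pulls forces an error: either the index
  of \<open>j\<close> falls below \<open>mu j - D / 3\<close> (event \<open>A\<close>), or the
  empirical mean of \<open>i\<close> reaches \<open>mu i + D / 3\<close> (event \<open>B\<close>).
  The expected number of such times is the sum of their probabilities.\<close>

lemma expected_pulls_le:
  assumes ij: "i \<in> set arms" "j \<in> set arms" and D: "0 < D" "mu i + D \<le> mu j"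
    and T: "2 \<le> T" "length arms \<le> T"
  shows "(\<integral>Y. real (pulls (hist Y T) i) \<partial>rewards) \<le>
    18 * ln (f_conf T) / D\<^sup>2 + 1 + 18 / D\<^sup>2 * (\<Sum>s=length arms..<T. 1 / f_conf (Suc s)) + real T / f_conf T"
proof -
  \<comment> \<open>This \<open>w\<close> serves twice: after \<open>w\<close> pulls the bonus is at
    most \<open>D / 3\<close>, and \<open>prob_overestimate\<close> gives exactly
    \<open>1 / f_conf T\<close>.\<close>
  define w where "w = 18 * ln (f_conf T) / D\<^sup>2"
  define A where "A n = {Y\<in>space rewards. 0 < pulls (hist Y n) j \<and>
      emp_mean (hist Y n) Y j + sqrt (2 * ln (f_conf (Suc n)) / real (pulls (hist Y n) j)) < mu j - D / 3}" for n
  define B where "B n = {Y\<in>space rewards. w \<le> real (pulls (hist Y n) i) \<and>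
      mu i + D / 3 \<le> emp_mean (hist Y n) Y i}" for n
  have ijk: "i < k" "j < k" using ij arms_lt by auto
  have fT: "1 < f_conf T" using T by (simp add: f_conf_def)
  then have w: "0 < w" using D by (simp add: w_def)
  have sets: "A n \<in> sets rewards" "B n \<in> sets rewards" if "n < T" for n
    unfolding A_def B_def using that
    by (rule_tac sets_emp_mean[OF ijk(2)] sets_emp_mean[OF ijk(1)]; measurable)+
  have pointwise: "real (pulls (hist Y T) i) \<le> w + 1 + (\<Sum>s=length arms..<T. indicator (A s) Y + indicator (B s) Y)"
    if Y: "Y \<in> space rewards" for Y
  proof -
    have "of_bool (hist Y T ! s = i \<and> w \<le> real (pulls (hist Y s) i)) \<le> (indicator (A s) Y + indicator (B s) Y :: real)"
      if s: "s \<in> {length arms..<T}" for s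
    proof (cases "hist Y T ! s = i \<and> w \<le> real (pulls (hist Y s) i) \<and> Y \<notin> A s")
      case True
      define N where "N = real (pulls (hist Y s) i)"
      have choice: "ucb_choose arms Y (hist Y s) (Suc s) = i"
        using True s by (simp add: ucb_hist_nth)
      have "ucb_index (hist Y s) Y (Suc s) j \<le> ucb_index (hist Y s) Y (Suc s) i"
        using ucb_choose_maximal(2)[OF arms_ne _ ij(2), of "Suc s" "hist Y s" Y] s choice by simp
      moreover have "mu j - D / 3 \<le> ucb_index (hist Y s) Y (Suc s) j"
        using True Y pulls_pos[OF ij(2), of s Y] s by (auto simp: A_def ucb_index_def not_less)
      moreover have "sqrt (2 * ln (f_conf (Suc s)) / N) \<le> D / 3"
      proof (rule real_le_lsqrt)
        have N: "w \<le> N" using True by (simp add: N_def)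
        have "ln (f_conf (Suc s)) \<le> ln (f_conf T)"
          using s f_conf_mono[of "Suc s" T] f_conf_ge_1[of "Suc s"] by (subst ln_le_cancel_iff) auto
        then have "2 * ln (f_conf (Suc s)) / N \<le> 2 * ln (f_conf T) / w"
          using N w fT by (intro frac_le) auto
        also have "\<dots> = (D / 3)\<^sup>2"
          using D fT by (simp add: w_def field_simps)
        finally show "2 * ln (f_conf (Suc s)) / N \<le> (D / 3)\<^sup>2" .
      qed (use D in auto)
      \<comment> \<open>The index of \<open>i\<close> is at least that of \<open>j\<close>, hence at
        least \<open>mu j - D / 3\<close>; removing a bonus of at most \<open>D / 3\<close> leaves
        \<open>mu j - 2 * D / 3\<close>, which is at least \<open>mu i + D / 3\<close>.\<close>
      ultimately have "mu i + D / 3 \<le> emp_mean (hist Y s) Y i"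
        using D unfolding ucb_index_def N_def by linarith
      then have "Y \<in> B s" using True Y by (simp add: B_def)
      then show ?thesis by simp
    qed (auto simp: indicator_def)
    then show ?thesis
      using pulls_le_count[OF distinct_arms arms_ne _ T(2), of w Y i] w
      by (smt (verit) sum_mono)
  qed
  have int: "integrable rewards (\<lambda>Y. indicator (A s) Y :: real)" "integrable rewards (\<lambda>Y. indicator (B s) Y :: real)"
    if "s \<in> {length arms..<T}" for s
    using sets[of s] that by (auto intro!: integrable_real_indicator simp: P.emeasure_finite less_top[symmetric])
  have "(\<integral>Y. real (pulls (hist Y T) i) \<partial>rewards) \<le>
      (\<integral>Y. w + 1 + (\<Sum>s=length arms..<T. indicator (A s) Y + indicator (B s) Y) \<partial>rewards)"
    by (intro integral_mono pointwise integrable_pulls Bochner_Integration.integrable_add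
        Bochner_Integration.integrable_sum int) auto
  also have "\<dots> = w + 1 + (\<Sum>s=length arms..<T. measure rewards (A s) + measure rewards (B s))"
  proof -
    have "(\<integral>Y. w + 1 + (\<Sum>s=length arms..<T. indicator (A s) Y + indicator (B s) Y) \<partial>rewards)
      = (\<integral>Y. w + 1 \<partial>rewards) + (\<integral>Y. (\<Sum>s=length arms..<T. indicator (A s) Y + indicator (B s) Y) \<partial>rewards)"
      by (intro Bochner_Integration.integral_add Bochner_Integration.integrable_add
        Bochner_Integration.integrable_sum int) auto
    also have "(\<integral>Y. (\<Sum>s=length arms..<T. indicator (A s) Y + indicator (B s) Y :: real) \<partial>rewards)
      = (\<Sum>s=length arms..<T. (\<integral>Y. indicator (A s) Y + indicator (B s) Y \<partial>rewards))"
      by (intro Bochner_Integration.integral_sum Bochner_Integration.integrable_add int)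
    also have "\<dots> = (\<Sum>s=length arms..<T. measure rewards (A s) + measure rewards (B s))"
      using sets sets.sets_into_space
      by (intro sum.cong refl, subst Bochner_Integration.integral_add) (auto intro!: int simp: Int_absorb1)
    finally show ?thesis using P.prob_space by simp
  qed
  also have "\<dots> \<le> w + 1 + (\<Sum>s=length arms..<T. 18 / D\<^sup>2 * (1 / f_conf (Suc s)) + 1 / f_conf T)"
  proof (intro add_left_mono sum_mono add_mono)
    fix s assume "s \<in> {length arms..<T}"
    then have s: "s \<le> T" by simp
    have "measure rewards (A s) \<le> exp (- ln (f_conf (Suc s))) * (2 / (D / 3)\<^sup>2)"
      unfolding A_def using D f_conf_ge_1[of "Suc s"] by (intro prob_underestimate[OF ijk(2) s]) auto
    then show "measure rewards (A s) \<le> 18 / D\<^sup>2 * (1 / f_conf (Suc s))"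
      using f_conf_ge_1[of "Suc s"] D by (simp add: exp_minus field_simps)
    have "measure rewards (B s) \<le> exp (- ((D / 3)\<^sup>2 * w / 2))"
      unfolding B_def using D w by (intro prob_overestimate[OF ijk(1) s]) auto
    also have "(D / 3)\<^sup>2 * w / 2 = ln (f_conf T)"
      using D by (simp add: w_def field_simps)
    finally show "measure rewards (B s) \<le> 1 / f_conf T"
      using fT by (simp add: exp_minus divide_inverse)
  qed
  also have "\<dots> \<le> w + 1 + (18 / D\<^sup>2 * (\<Sum>s=length arms..<T. 1 / f_conf (Suc s)) + real T / f_conf T)"
  proof -
    have "real (T - length arms) / f_conf T \<le> real T / f_conf T"
      using fT by (intro divide_right_mono) auto
    then show ?thesis
      unfolding sum.distrib sum_distrib_left[symmetric] by simp
  qed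
  finally show ?thesis by (simp add: w_def)
qed

text \<open>The constant is \<open>20 = 18 + 1 + 1\<close>: the series is at most \<open>1\<close>,
  \<open>T / f_conf T\<close> is at most \<open>1\<close>, and \<open>D \<le> 1\<close> lets both
  units be absorbed into \<open>1 / D^2\<close>.\<close>

lemma expected_pulls_le':
  assumes "i \<in> set arms" "j \<in> set arms" "0 < D" "D \<le> 1" "mu i + D \<le> mu j" "3 \<le> length arms" "length arms \<le> T"
  shows "(\<integral>Y. real (pulls (hist Y T) i) \<partial>rewards) \<le> (20 + 18 * ln (f_conf T)) / D\<^sup>2"
proof -
  have D: "D\<^sup>2 \<le> 1" "0 < D\<^sup>2" using assms power_le_one[of D 2] by auto
  have T: "3 \<le> T" using assms by simp
  have "1 \<le> (ln (real T))\<^sup>2" using ln_ge_1[of "real T"] T by simp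
  then have "real T * 1 \<le> real T * (ln (real T))\<^sup>2" by (intro mult_left_mono) auto
  then have "real T / f_conf T \<le> 1"
    using f_conf_ge_1[of T] by (simp add: f_conf_def)
  moreover have "18 / D\<^sup>2 * (\<Sum>s=length arms..<T. 1 / f_conf (Suc s)) \<le> 18 / D\<^sup>2 * 1"
    using sum_inverse_f_conf_le[OF assms(6), of T] by (intro mult_left_mono) auto
  moreover have "1 \<le> 1 / D\<^sup>2" using D by (simp add: field_simps)
  ultimately have "18 * ln (f_conf T) / D\<^sup>2 + 1 + 18 / D\<^sup>2 * (\<Sum>s=length arms..<T. 1 / f_conf (Suc s)) + real T / f_conf T
     \<le> 18 * ln (f_conf T) / D\<^sup>2 + 1 / D\<^sup>2 + 18 / D\<^sup>2 * 1 + 1 / D\<^sup>2"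
    by linarith
  also have "\<dots> = (20 + 18 * ln (f_conf T)) / D\<^sup>2" by (simp add: add_divide_distrib)
  finally show ?thesis
    using expected_pulls_le[OF assms(1,2,3,5) _ assms(7)] T by linarith
qed

text \<open>Near arms lose at most \<open>2 * th\<close> per pull and all pulls together number
  \<open>T\<close>; far arms are controlled by comparison with the good arm
  \<open>j\<close>.\<close>

lemma expected_loss_le:
  assumes mu: "\<And>i. i \<in> set arms \<Longrightarrow> mu i \<in> {0..1}" and th: "0 < th"
    and j: "j \<in> set arms" "1 - th < mu j" and m: "3 \<le> length arms" "length arms \<le> T"
  shows "(\<integral>Y. (\<Sum>s<T. 1 - mu (hist Y T ! s)) \<partial>rewards) \<le>
    2 * th * real T + (20 + 18 * ln (f_conf T)) * (\<Sum>i\<in>set arms. gap_cost th (mu i))"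
proof -
  define K where "K = 20 + 18 * ln (f_conf T)"
  have K: "0 \<le> K" using f_conf_ge_1[of T] by (simp add: K_def)
  let ?N = "\<lambda>Y i. real (pulls (hist Y T) i)"
  let ?far = "\<lambda>i. 2 * th < 1 - mu i"
  have loss: "(\<Sum>s<T. 1 - mu (hist Y T ! s)) = (\<Sum>i\<in>set arms. ?N Y i * (1 - mu i))" for Y
    using sum_pulls[of "set arms" "hist Y T" "\<lambda>i. 1 - mu i"] ucb_hist_in_arms[OF arms_ne] by simp
  have total: "real T = (\<Sum>i\<in>set arms. ?N Y i)" for Y
    using sum_pulls[of "set arms" "hist Y T" "\<lambda>_. 1"] ucb_hist_in_arms[OF arms_ne] by simp
  have le: "(\<Sum>s<T. 1 - mu (hist Y T ! s)) \<le>
      2 * th * real T + (\<Sum>i\<in>set arms. if ?far i then ?N Y i * (1 - mu i) else 0)" for Y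
  proof -
    have "(\<Sum>i\<in>set arms. ?N Y i * (1 - mu i)) \<le>
        (\<Sum>i\<in>set arms. 2 * th * ?N Y i + (if ?far i then ?N Y i * (1 - mu i) else 0))"
    proof (rule sum_mono)
      fix i
      have "?N Y i * (1 - mu i) \<le> ?N Y i * (2 * th)" if "\<not> ?far i"
        using that by (intro mult_left_mono) auto
      then show "?N Y i * (1 - mu i) \<le> 2 * th * ?N Y i + (if ?far i then ?N Y i * (1 - mu i) else 0)"
        using th by (simp add: mult_ac)
    qed
    also have "\<dots> = 2 * th * real T + (\<Sum>i\<in>set arms. if ?far i then ?N Y i * (1 - mu i) else 0)"
      unfolding total[of Y] by (simp add: sum.distrib sum_distrib_left)
    finally show ?thesis by (simp add: loss)
  qed
  have int: "integrable rewards (\<lambda>Y. if ?far i then ?N Y i * (1 - mu i) else 0)" for i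
    by (cases "?far i") (simp_all add: integrable_pulls)
  have int_loss: "integrable rewards (\<lambda>Y. \<Sum>s<T. 1 - mu (hist Y T ! s))"
  proof (rule integrable_hist[where g = "\<lambda>h. \<Sum>s<T. 1 - mu (h ! s)" and B = "real T"])
    fix h assume h: "length h = T" "set h \<subseteq> set arms"
    have "\<bar>\<Sum>s<T. 1 - mu (h ! s)\<bar> \<le> (\<Sum>s<T. \<bar>1 - mu (h ! s)\<bar>)" by (rule sum_abs)
    also have "\<dots> \<le> (\<Sum>s<T. 1)"
    proof (rule sum_mono)
      fix s assume "s \<in> {..<T}"
      then have "mu (h ! s) \<in> {0..1}" using h nth_mem[of s h] by (intro mu) auto
      then show "\<bar>1 - mu (h ! s)\<bar> \<le> 1" by auto
    qed
    finally show "\<bar>\<Sum>s<T. 1 - mu (h ! s)\<bar> \<le> real T" by simp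
  qed simp
  have "(\<integral>Y. (\<Sum>s<T. 1 - mu (hist Y T ! s)) \<partial>rewards) \<le>
      (\<integral>Y. 2 * th * real T + (\<Sum>i\<in>set arms. if ?far i then ?N Y i * (1 - mu i) else 0) \<partial>rewards)"
    by (intro integral_mono[OF int_loss] le Bochner_Integration.integrable_add Bochner_Integration.integrable_sum int) auto
  also have "\<dots> = 2 * th * real T +
      (\<Sum>i\<in>set arms. (\<integral>Y. (if ?far i then ?N Y i * (1 - mu i) else 0) \<partial>rewards))"
    by (subst Bochner_Integration.integral_add, auto intro!: int)
       (subst Bochner_Integration.integral_sum, auto intro!: int simp: P.prob_space)
  also have "\<dots> \<le> 2 * th * real T + (\<Sum>i\<in>set arms. K * gap_cost th (mu i))"
  proof (intro add_left_mono sum_mono)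
    fix i assume i: "i \<in> set arms"
    show "(\<integral>Y. (if ?far i then ?N Y i * (1 - mu i) else 0) \<partial>rewards) \<le> K * gap_cost th (mu i)"
    proof (cases "?far i")
      case True
      \<comment> \<open>The pull bound is applied with \<open>D = 1 - mu i - th\<close>, so that
        \<open>mu i + D = 1 - th < mu j\<close>.\<close>
      have "(\<integral>Y. ?N Y i \<partial>rewards) \<le> K / (1 - mu i - th)\<^sup>2"
        unfolding K_def using True mu[OF i] th j by (intro expected_pulls_le'[OF i j(1) _ _ _ m]) auto
      then have "(\<integral>Y. ?N Y i \<partial>rewards) * (1 - mu i) \<le> K / (1 - mu i - th)\<^sup>2 * (1 - mu i)"
        using mu[OF i] by (intro mult_right_mono) auto
      then show ?thesis using True mu[OF i] by (simp add: gap_cost_def)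
    next
      case False
      then show ?thesis using K th by (simp add: gap_cost_nonneg)
    qed
  qed
  finally show ?thesis by (simp add: K_def sum_distrib_left)
qed

end

section \<open>Averaging over the prior\<close>

text \<open>Keeps the claimed bound nonnegative when \<open>th\<close> is so large that
  \<open>5 - ln th\<close> is negative: the quadratic term outgrows the product of
  logarithms.\<close>

lemma f_conf_growth_nonneg:
  assumes T: "2 \<le> T" and th: "0 < th"
  shows "0 \<le> real T * th\<^sup>2 + (20 + 36 * ln (f_conf T)) * (5 - ln th)"
proof (cases "ln th \<le> 5")
  case True
  then show ?thesis using f_conf_ge_1[of T] by (intro add_nonneg_nonneg mult_nonneg_nonneg) auto
next
  case False
  \<comment> \<open>Crude growth suffices: \<open>f_conf T \<le> T^4\<close> gives
    \<open>ln (f_conf T) \<le> 4 * T\<close>, and \<open>20 \<le> 10 * T\<close> then accounts for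
    the constant \<open>154\<close>.\<close>
  have "f_conf T \<le> 2 * real T ^ 3"
  proof -
    have "(ln (real T))\<^sup>2 \<le> (real T)\<^sup>2"
      using T by (intro power_mono order.trans[OF ln_le_minus_one]) auto
    then have "real T * (ln (real T))\<^sup>2 \<le> real T * (real T)\<^sup>2" by (intro mult_left_mono) auto
    moreover have "1 \<le> real T ^ 3" using T by (intro one_le_power) auto
    ultimately show ?thesis by (simp add: f_conf_def power3_eq_cube power2_eq_square)
  qed
  also have "\<dots> \<le> real T * real T ^ 3" using T by (intro mult_right_mono) auto
  also have "\<dots> = real T ^ 4" by (simp add: eval_nat_numeral)
  finally have "ln (f_conf T) \<le> ln (real T ^ 4)"
    using T f_conf_ge_1[of T] by (subst ln_le_cancel_iff) auto
  also have "\<dots> = 4 * ln (real T)" using T by (simp add: ln_realpow)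
  also have "\<dots> \<le> 4 * real T" using T ln_le_minus_one[of "real T"] by simp
  finally have "20 + 36 * ln (f_conf T) \<le> 154 * real T" using T by simp
  moreover have "ln th - 5 \<le> th / 32"
  proof -
    have "(2::real) \<le> exp 1" using exp_ge_add_one_self[of 1] by simp
    then have "(2::real) ^ 5 \<le> exp 1 ^ 5" by (intro power_mono) auto
    then have e5: "32 \<le> exp (5::real)" by (simp add: exp_of_nat_mult[symmetric])
    have "ln (th / exp 5) \<le> th / exp 5 - 1" using th by (intro ln_le_minus_one) auto
    also have "\<dots> \<le> th / exp 5" by simp
    also have "\<dots> \<le> th / 32" using th e5 by (intro divide_left_mono) auto
    finally show ?thesis using th by (simp add: ln_div)
  qed
  ultimately have "(20 + 36 * ln (f_conf T)) * (ln th - 5) \<le> (154 * real T) * (th / 32)"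
    using False T by (intro mult_mono) auto
  also have "\<dots> \<le> real T * th\<^sup>2"
  proof -
    \<comment> \<open>Since \<open>ln th > 5\<close>, this yields \<open>th > 6\<close>, more than
      \<open>154 / 32\<close>.\<close>
    have "ln th \<le> th - 1" using th by (rule ln_le_minus_one)
    then have "154 / 32 * th \<le> th * th" using False by (intro mult_right_mono) auto
    then have "real T * (154 / 32 * th) \<le> real T * (th * th)" by (intro mult_left_mono) auto
    then show ?thesis by (simp add: power2_eq_square mult_ac)
  qed
  finally show ?thesis by (simp add: algebra_simps)
qed

text \<open>Only tail probabilities of the prior are controlled, so a layer-cake representation and
  Tonelli move the integral onto the tails, where the linear bound \<open>C * y\<close>
  applies.\<close>

lemma integral_gap_cost_le:
  assumes prob: "prob_space M" and sets_M: "sets M = sets borel"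
    and th: "0 < th" "2 * th < 1" and C: "0 \<le> C"
    and tail: "\<And>y. 0 < y \<Longrightarrow> y \<le> 1 \<Longrightarrow> measure M {x. 1 - y \<le> x} \<le> C * y"
  shows "(\<integral>x. gap_cost th x \<partial>M) \<le> C * (5 - ln th)"
proof -
  interpret prob_space M by fact
  interpret pair_sigma_finite M lborel ..
  note sets_M[measurable_cong]
  define g where "g u = u / (u - th)\<^sup>2" for u
  define h where "h u = 1 / (u - th)\<^sup>2 + 2 * th / (u - th) ^ 3" for u
  \<comment> \<open>Integration by parts: a primitive of \<open>u * h u\<close> is
    \<open>- u * g u\<close> plus a primitive of
    \<open>g u = 1 / (u - th) + th / (u - th)^2\<close>.\<close>
  define H where "H u = u * (- g u) + (ln (u - th) - th / (u - th))" for u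
  have h_nonneg: "0 \<le> h u" if "2 * th \<le> u" for u
    using that th by (auto simp: h_def)
  have g_deriv: "((\<lambda>u. - g u) has_real_derivative h u) (at u)" if "2 * th \<le> u" for u
  proof -
    have u: "u - th > 0" using that th by simp
    have "((\<lambda>u. - (u / (u - th)\<^sup>2)) has_real_derivative
        - ((1 * (u - th)\<^sup>2 - u * (2 * (u - th))) / ((u - th)\<^sup>2 * (u - th)\<^sup>2))) (at u)"
      using u by (auto intro!: derivative_eq_intros)
    also have "- ((1 * (u - th)\<^sup>2 - u * (2 * (u - th))) / ((u - th)\<^sup>2 * (u - th)\<^sup>2)) = h u"
    proof -
      have "- ((1 * v\<^sup>2 - (v + th) * (2 * v)) / (v\<^sup>2 * v\<^sup>2)) = 1 / v\<^sup>2 + 2 * th / v ^ 3" if "v > 0" for v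
        using that by (simp add: field_simps power2_eq_square power3_eq_cube)
      from this[OF u] show ?thesis by (simp add: h_def)
    qed
    finally show ?thesis by (simp add: g_def)
  qed
  have H_deriv: "(H has_real_derivative h u * u) (at u)" if "2 * th \<le> u" for u
  proof -
    have u: "u - th > 0" using that th by simp
    have "((\<lambda>u. ln (u - th) - th / (u - th)) has_real_derivative 1 / (u - th) + th / (u - th)\<^sup>2) (at u)"
      using u by (auto intro!: derivative_eq_intros simp: power2_eq_square)
    also have "1 / (u - th) + th / (u - th)\<^sup>2 = g u"
    proof -
      have "1 / v + th / v\<^sup>2 = (v + th) / v\<^sup>2" if "v > 0" for v
        using that by (simp add: field_simps power2_eq_square)
      from this[OF u] show ?thesis by (simp add: g_def)
    qed
    finally have "((\<lambda>u. ln (u - th) - th / (u - th)) has_real_derivative g u) (at u)" .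
    from DERIV_add[OF DERIV_mult[OF DERIV_ident g_deriv[OF that]] this]
    show ?thesis by (simp add: H_def[abs_def])
  qed
  have g_antimono: "g 1 \<le> g u" if "2 * th \<le> u" "u \<le> 1" for u
  proof -
    have "- g u \<le> - g 1"
    proof (rule DERIV_nonneg_imp_nondecreasing[OF that(2), of "\<lambda>u. - g u"])
      fix z assume "u \<le> z"
      then show "\<exists>d. ((\<lambda>u. - g u) has_real_derivative d) (at z) \<and> 0 \<le> d"
        using g_deriv[of z] h_nonneg[of z] that by (intro exI[of _ "h z"]) auto
    qed
    then show ?thesis by simp
  qed
  have H_mono: "H (2 * th) \<le> H 1"
  proof (rule DERIV_nonneg_imp_nondecreasing[of "2 * th" 1 H])
    fix z assume "2 * th \<le> z"
    then show "\<exists>d. (H has_real_derivative d) (at z) \<and> 0 \<le> d"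
      using H_deriv[of z] h_nonneg[of z] th by (intro exI[of _ "h z * z"]) auto
  qed (use th in simp)
  have h_meas [measurable]: "h \<in> borel_measurable borel"
    unfolding h_def[abs_def] by measurable
  have tail': "emeasure M {x. 1 - y \<le> x} \<le> ennreal (C * y)" if "0 < y" "y \<le> 1" for y
    unfolding emeasure_eq_measure using tail[OF that] by (rule ennreal_leI)
  let ?k = "\<lambda>x y. if 1 - y \<le> x then ennreal (h y) * indicator {2 * th..1} y else 0"
  txt \<open>\<open>u = 1 - x\<close> is the distance to the top and \<open>h = - g'\<close>, so that \<open>g u\<close> equals \<open>g 1\<close> plus the
    integral of \<open>h\<close> over \<open>{u..1}\<close>; \<open>H\<close> is a primitive of \<open>h u * u\<close>.\<close>
  have layer: "ennreal (gap_cost th x) \<le> ennreal (g 1) * indicator {0..} x + (\<integral>\<^sup>+y. ?k x y \<partial>lborel)" for x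
  proof (cases "0 \<le> x \<and> 2 * th < 1 - x")
    case True
    have "(\<integral>\<^sup>+y. ennreal (h y) * indicator {1 - x..1} y \<partial>lborel) = ennreal (- g 1 - - g (1 - x))"
      using True th g_deriv h_nonneg by (intro nn_integral_FTC_Icc) auto
    moreover have "(\<integral>\<^sup>+y. ennreal (h y) * indicator {1 - x..1} y \<partial>lborel) = (\<integral>\<^sup>+y. ?k x y \<partial>lborel)"
      using True by (intro nn_integral_cong) (auto simp: indicator_def)
    moreover have "0 \<le> - g 1 - - g (1 - x)"
      using True g_antimono[of "1 - x"] by simp
    moreover have "0 \<le> g 1" by (simp add: g_def)
    moreover have "gap_cost th x = g (1 - x)" using True by (simp add: gap_cost_def g_def)
    ultimately show ?thesis using True by (simp add: ennreal_plus[symmetric] del: ennreal_plus)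
  qed (auto simp: gap_cost_def)
  have "(\<integral>\<^sup>+x. ennreal (gap_cost th x) \<partial>M) \<le>
      (\<integral>\<^sup>+x. ennreal (g 1) * indicator {0..} x + (\<integral>\<^sup>+y. ?k x y \<partial>lborel) \<partial>M)"
    by (intro nn_integral_mono layer)
  also have "\<dots> = ennreal (g 1) * emeasure M {0..} + (\<integral>\<^sup>+x. (\<integral>\<^sup>+y. ?k x y \<partial>lborel) \<partial>M)"
    by (subst nn_integral_add) (auto simp: nn_integral_cmult_indicator)
  also have "(\<integral>\<^sup>+x. (\<integral>\<^sup>+y. ?k x y \<partial>lborel) \<partial>M) = (\<integral>\<^sup>+y. (\<integral>\<^sup>+x. ?k x y \<partial>M) \<partial>lborel)"
    by (rule Fubini'[symmetric]) measurable
  also have "\<dots> \<le> (\<integral>\<^sup>+y. ennreal (C * (h y * y)) * indicator {2 * th..1} y \<partial>lborel)"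
  proof (intro nn_integral_mono)
    fix y :: real
    have "(\<integral>\<^sup>+x. ?k x y \<partial>M) = (\<integral>\<^sup>+x. ennreal (h y) * indicator {2 * th..1} y * indicator {x. 1 - y \<le> x} x \<partial>M)"
      by (intro nn_integral_cong) (auto simp: indicator_def)
    also have "\<dots> = ennreal (h y) * indicator {2 * th..1} y * emeasure M {x. 1 - y \<le> x}"
      by (intro nn_integral_cmult_indicator) measurable
    also have "\<dots> \<le> ennreal (C * (h y * y)) * indicator {2 * th..1} y"
    proof (cases "y \<in> {2 * th..1}")
      case True
      then have "ennreal (h y) * emeasure M {x. 1 - y \<le> x} \<le> ennreal (h y) * ennreal (C * y)"
        using th by (intro mult_left_mono tail') auto
      also have "\<dots> = ennreal (C * (h y * y))"
        using True th C h_nonneg[of y] by (subst ennreal_mult[symmetric]) (auto simp: mult_ac)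
      finally show ?thesis using True by simp
    qed simp
    finally show "(\<integral>\<^sup>+x. ?k x y \<partial>M) \<le> ennreal (C * (h y * y)) * indicator {2 * th..1} y" .
  qed
  also have "\<dots> = ennreal (C * H 1 - C * H (2 * th))"
    using th C h_nonneg H_deriv by (intro nn_integral_FTC_Icc) (auto intro!: DERIV_cmult mult_nonneg_nonneg)
  also have "emeasure M {0..} \<le> ennreal C"
    using tail'[of 1] by (simp add: atLeast_def)
  finally have "(\<integral>\<^sup>+x. ennreal (gap_cost th x) \<partial>M) \<le> ennreal (g 1) * ennreal C + ennreal (C * H 1 - C * H (2 * th))"
    by (simp add: mult_left_mono add_right_mono)
  also have "\<dots> = ennreal (g 1 * C + (C * H 1 - C * H (2 * th)))"
  proof -
    have "C * H (2 * th) \<le> C * H 1"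
      using C H_mono by (rule mult_left_mono[rotated])
    moreover have "0 \<le> g 1" by (simp add: g_def)
    ultimately show ?thesis using C by (simp add: ennreal_mult ennreal_plus)
  qed
  also have "\<dots> \<le> ennreal (C * (5 - ln th))"
  proof (rule ennreal_leI)
    \<comment> \<open>The constant \<open>5\<close> is \<open>4 + 1\<close>:
      \<open>2 * th * g (2 * th) = 4\<close>, and \<open>th / (u - th) = 1\<close> at
      \<open>u = 2 * th\<close>. At the upper end \<open>- g 1\<close> cancels the boundary term of
      the layer-cake formula.\<close>
    have "H (2 * th) = ln th - 5" using th by (simp add: H_def g_def power2_eq_square)
    moreover have "H 1 \<le> - g 1"
    proof -
      have "ln (1 - th) \<le> 0" "0 \<le> th / (1 - th)" using th by (auto simp: ln_le_zero_iff)
      then show ?thesis by (simp add: H_def)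
    qed
    ultimately have "C * (g 1 + H 1 - H (2 * th)) \<le> C * (5 - ln th)"
      using C by (intro mult_left_mono) auto
    then show "g 1 * C + (C * H 1 - C * H (2 * th)) \<le> C * (5 - ln th)"
      by (simp add: algebra_simps)
  qed
  finally show ?thesis
  proof (rule integral_real_bounded[rotated])
    have "ln th \<le> 0" using th by (simp add: ln_le_zero_iff)
    then show "0 \<le> C * (5 - ln th)" using C by (intro mult_nonneg_nonneg) auto
  qed
qed

section \<open>Regret for fixed means\<close>

context subgaussian_ucb begin

lemma integrable_mean_pulled:
  assumes "\<And>i. i \<in> set arms \<Longrightarrow> mu i \<in> {0..1}" "s < T"
  shows "integrable rewards (\<lambda>Y. mu (hist Y T ! s))"
proof (rule integrable_hist[where g = "\<lambda>h. mu (h ! s)" and B = 1])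
  fix h :: "nat list" assume "length h = T" "set h \<subseteq> set arms"
  then have "mu (h ! s) \<in> {0..1}" using assms(2) nth_mem[of s h] by (intro assms(1)) auto
  then show "\<bar>mu (h ! s)\<bar> \<le> 1" by auto
qed simp

lemma integral_loss:
  assumes "\<And>i. i \<in> set arms \<Longrightarrow> mu i \<in> {0..1}"
  shows "(\<integral>Y. (\<Sum>s<T. 1 - mu (hist Y T ! s)) \<partial>rewards) =
    real T - (\<Sum>t\<in>{1..T}. \<integral>Y. mu (hist Y T ! (t - 1)) \<partial>rewards)"
proof -
  have "(\<integral>Y. (\<Sum>s<T. 1 - mu (hist Y T ! s)) \<partial>rewards) = (\<Sum>s<T. \<integral>Y. 1 - mu (hist Y T ! s) \<partial>rewards)"
    using integrable_mean_pulled[OF assms] by (intro Bochner_Integration.integral_sum) auto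
  also have "\<dots> = (\<Sum>s<T. 1 - (\<integral>Y. mu (hist Y T ! s) \<partial>rewards))"
    using integrable_mean_pulled[OF assms]
    by (intro sum.cong refl, subst Bochner_Integration.integral_diff) (auto simp: P.prob_space)
  also have "\<dots> = real T - (\<Sum>t\<in>{1..T}. \<integral>Y. mu (hist Y T ! (t - 1)) \<partial>rewards)"
    by (simp add: sum_subtractf sum.atLeast1_atMost_eq)
  finally show ?thesis .
qed

lemma integral_mean_pulled_nonneg:
  assumes "\<And>i. i \<in> set arms \<Longrightarrow> mu i \<in> {0..1}" "s < T"
  shows "0 \<le> (\<integral>Y. mu (hist Y T ! s) \<partial>rewards)"
proof (rule integral_nonneg_AE, rule AE_I2)
  fix Y
  have "hist Y T ! s \<in> set arms"
    using ucb_hist_in_arms[OF arms_ne, of Y T] nth_mem[of s "hist Y T"] assms(2) by auto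
  then show "0 \<le> mu (hist Y T ! s)" using assms(1)[of "hist Y T ! s"] by auto
qed

end

context
  fixes P :: "real \<Rightarrow> real measure"
  assumes fam_prob: "\<And>mu. mu \<in> {0..1} \<Longrightarrow> prob_space (P mu) \<and> sets (P mu) = sets borel"
    and fam_subg: "\<And>mu. mu \<in> {0..1} \<Longrightarrow> subgaussian1 (P mu) mu"
begin

text \<open>\<open>P\<close> is controlled only on the unit interval, so indices beyond
  \<open>k\<close> get a point mass. The reward table is unaffected, as its index set contains only
  arms below \<open>k\<close>.\<close>

lemma subgaussian_ucb_subsample:
  assumes mu: "\<And>i. i < k \<Longrightarrow> mu i \<in> {0..1}" and S: "S \<subseteq> {0..<k}" "S \<noteq> {}"
  shows "subgaussian_ucb (\<lambda>i. if i < k then P (mu i) else return borel 0) mu k (sorted_list_of_set S)"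
proof (rule subgaussian_ucb.intro)
  show "distinct (sorted_list_of_set S)" by simp
  have "finite S" using S(1) finite_subset by blast
  then show "set (sorted_list_of_set S) \<subseteq> {0..<k}" "sorted_list_of_set S \<noteq> []" using S by auto
  fix i
  show "prob_space (if i < k then P (mu i) else return borel 0)"
    using fam_prob[OF mu, of i] by (cases "i < k") (simp_all add: prob_space_return)
  show "sets (if i < k then P (mu i) else return borel 0) = sets borel"
    using fam_prob[OF mu, of i] by (cases "i < k") simp_all
  show "subgaussian1 (if i < k then P (mu i) else return borel 0) (mu i)" if "i < k"
    using fam_subg[OF mu[OF that]] that by simp
qed

lemma reward_table_eq:
  "reward_table P mu k T = PiM ({0..<k} \<times> {Suc 0..T}) (\<lambda>(i, t). if i < k then P (mu i) else return borel 0)"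
  unfolding reward_table_def by (intro PiM_cong) auto

text \<open>Replacing the best mean by \<open>1\<close> makes the benchmark independent of the
  sample; the uniform expectation is then a plain average over the \<open>m\<close>-subsets.\<close>

lemma ss_ucb_regret_le_average:
  assumes mu: "\<And>i. i < k \<Longrightarrow> mu i \<in> {0..1}" and m: "0 < m" "m \<le> k"
    and B: "\<And>S. S \<subseteq> {0..<k} \<Longrightarrow> card S = m \<Longrightarrow>
       real T - (\<Sum>t\<in>{1..T}. \<integral>Y. mu (ucb_hist (sorted_list_of_set S) Y T ! (t - 1)) \<partial>reward_table P mu k T) \<le> B S"
  shows "ss_ucb_regret P k T m mu \<le> (\<Sum>S | S \<subseteq> {0..<k} \<and> card S = m. B S) / real (k choose m)"
proof -
  define F where "F = {S. S \<subseteq> {0..<k} \<and> card S = m}"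
  let ?I = "\<lambda>S t. \<integral>Y. mu (ucb_hist (sorted_list_of_set S) Y T ! (t - 1)) \<partial>reward_table P mu k T"
  have card: "card F = k choose m" unfolding F_def using n_subsets[of "{0..<k}" m] by simp
  then have pos: "0 < real (card F)" using m by (simp add: zero_less_binomial_iff)
  then have F: "F \<noteq> {}" "finite F" by (auto simp: card_gt_0_iff)
  have "Max (mu ` {0..<k}) \<le> 1" using mu m by (subst Max_le_iff) auto
  then have "real T * Max (mu ` {0..<k}) \<le> real T * 1" by (intro mult_left_mono) auto
  then have "ss_ucb_regret P k T m mu \<le> real T - (\<Sum>t\<in>{1..T}. (\<Sum>S\<in>F. ?I S t) / card F)"
    unfolding ss_ucb_regret_def subsample_def F_def[symmetric] using F by (simp add: integral_pmf_of_set)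
  also have "(\<Sum>t\<in>{1..T}. (\<Sum>S\<in>F. ?I S t) / card F) = (\<Sum>S\<in>F. \<Sum>t\<in>{1..T}. ?I S t) / card F"
    by (subst sum.swap) (simp add: sum_divide_distrib)
  also have "real T - (\<Sum>S\<in>F. \<Sum>t\<in>{1..T}. ?I S t) / card F = (\<Sum>S\<in>F. real T - (\<Sum>t\<in>{1..T}. ?I S t)) / card F"
    using pos by (simp add: sum_subtractf diff_divide_distrib)
  also have "\<dots> \<le> (\<Sum>S\<in>F. B S) / card F"
    using pos B F_def by (intro divide_right_mono sum_mono) auto
  finally show ?thesis unfolding card by (simp only: F_def)
qed

lemma ss_ucb_regret_le_T:
  assumes mu: "\<And>i. i < k \<Longrightarrow> mu i \<in> {0..1}" and m: "0 < m" "m \<le> k"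
  shows "ss_ucb_regret P k T m mu \<le> real T"
proof -
  have "ss_ucb_regret P k T m mu \<le> (\<Sum>S | S \<subseteq> {0..<k} \<and> card S = m. real T) / real (k choose m)"
  proof (rule ss_ucb_regret_le_average[OF mu m])
    fix S assume S: "S \<subseteq> {0..<k}" "card S = m"
    then have S': "S \<noteq> {}" "finite S" using m by (auto intro: finite_subset)
    interpret subgaussian_ucb "\<lambda>i. if i < k then P (mu i) else return borel 0" mu k T "sorted_list_of_set S"
      by (rule subgaussian_ucb_subsample[OF mu S(1) S'(1)])
    have mu': "mu i \<in> {0..1}" if "i \<in> set (sorted_list_of_set S)" for i
      using that S S' by (intro mu) auto
    have "0 \<le> (\<Sum>t\<in>{1..T}. \<integral>Y. mu (ucb_hist (sorted_list_of_set S) Y T ! (t - 1)) \<partial>reward_table P mu k T)"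
      unfolding reward_table_eq by (intro sum_nonneg integral_mean_pulled_nonneg mu') auto
    then show "real T - (\<Sum>t\<in>{1..T}. \<integral>Y. mu (ucb_hist (sorted_list_of_set S) Y T ! (t - 1)) \<partial>reward_table P mu k T) \<le> real T"
      by simp
  qed
  also have "\<dots> = real T"
    using n_subsets[of "{0..<k}" m] m by (simp add: zero_less_binomial_iff)
  finally show ?thesis .
qed

text \<open>A sample without an arm above \<open>1 - th\<close> pays the trivial \<open>T\<close>;
  any other falls under \<open>expected_loss_le\<close>. The indicator merges both cases into a
  function of \<open>mu\<close> that can be integrated term by term.\<close>

lemma ss_ucb_regret_le:
  assumes mu: "\<And>i. i < k \<Longrightarrow> mu i \<in> {0..1}" and m: "3 \<le> m" "m \<le> k" "m \<le> T" and th: "0 < th"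
  shows "ss_ucb_regret P k T m mu \<le>
    (\<Sum>S | S \<subseteq> {0..<k} \<and> card S = m. real T * of_bool (\<forall>i\<in>S. mu i \<le> 1 - th) + 2 * th * real T
       + (20 + 18 * ln (f_conf T)) * (\<Sum>i\<in>S. gap_cost th (mu i))) / real (k choose m)"
proof (rule ss_ucb_regret_le_average[OF mu])
  fix S assume S: "S \<subseteq> {0..<k}" "card S = m"
  then have S': "S \<noteq> {}" "finite S" using m by (auto intro: finite_subset)
  interpret subgaussian_ucb "\<lambda>i. if i < k then P (mu i) else return borel 0" mu k T "sorted_list_of_set S"
    by (rule subgaussian_ucb_subsample[OF mu S(1) S'(1)])
  let ?I = "\<lambda>t. \<integral>Y. mu (ucb_hist (sorted_list_of_set S) Y T ! (t - 1)) \<partial>reward_table P mu k T"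
  let ?G = "(20 + 18 * ln (f_conf T)) * (\<Sum>i\<in>S. gap_cost th (mu i))"
  have mu': "mu i \<in> {0..1}" if "i \<in> set (sorted_list_of_set S)" for i
    using that S S' by (intro mu) auto
  have G: "0 \<le> ?G"
    using f_conf_ge_1[of T] th by (intro mult_nonneg_nonneg sum_nonneg gap_cost_nonneg) auto
  show "real T - (\<Sum>t\<in>{1..T}. ?I t) \<le> real T * of_bool (\<forall>i\<in>S. mu i \<le> 1 - th) + 2 * th * real T + ?G"
  proof (cases "\<forall>i\<in>S. mu i \<le> 1 - th")
    case True
    have "0 \<le> (\<Sum>t\<in>{1..T}. ?I t)"
      unfolding reward_table_eq by (intro sum_nonneg integral_mean_pulled_nonneg mu') auto
    moreover have "0 \<le> 2 * th * real T" using th by simp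
    ultimately show ?thesis using True G by simp
  next
    case False
    then obtain j where j: "j \<in> S" "1 - th < mu j" by (auto simp: not_le)
    then show ?thesis
      using expected_loss_le[OF mu' th, of j] integral_loss[OF mu'] S S' m False
      unfolding reward_table_eq by simp
  qed
qed (use m in auto)

end

section \<open>The Bayesian regret\<close>

lemma abs_gap_cost_le:
  assumes "0 < th"
  shows "\<bar>gap_cost th x\<bar> \<le> 1 / th\<^sup>2"
proof (cases "0 \<le> x \<and> 2 * th < 1 - x")
  case True
  have "(1 - x) / (1 - x - th)\<^sup>2 \<le> 1 / th\<^sup>2"
    using True assms by (intro frac_le power_mono) auto
  then show ?thesis using True assms by (simp add: gap_cost_def)
qed (use assms in \<open>auto simp: gap_cost_def\<close>)

lemma gap_cost_measurable [measurable]: "gap_cost th \<in> borel_measurable borel"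
  unfolding gap_cost_def[abs_def] by measurable

text \<open>Regularity at radius \<open>1\<close>: the lower bound is on a probability, and the
  upper bound is on a set containing the support.\<close>

lemma prior_constants:
  assumes "prob_space M" "measure M {0..1} = 1" "sets M = sets borel" "one_regular M c0 C0"
  shows "c0 \<le> 1" "1 \<le> C0"
proof -
  interpret prob_space M by fact
  have "\<forall>\<epsilon>\<in>{0<..1}. c0 * \<epsilon> \<le> measure M {x. 1 - \<epsilon> < x} \<and> measure M {x. 1 - \<epsilon> \<le> x} \<le> C0 * \<epsilon>"
    using assms(4) unfolding one_regular_def by blast
  from bspec[OF this, of 1]
  have "c0 * 1 \<le> measure M {x. 1 - 1 < x}" "measure M {x. 1 - 1 \<le> x} \<le> C0 * 1"
    by auto
  moreover have "measure M {0..1} \<le> measure M {x. 1 - 1 \<le> x}"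
    using assms(3) by (intro finite_measure_mono) auto
  moreover note prob_le_1[of "{x. 1 - 1 < x}"] assms(2)
  ultimately show "c0 \<le> 1" "1 \<le> C0" by linarith+
qed

text \<open>For a fixed sample, independence turns the absence of a good arm into a power of one
  tail probability, and every cost term has the same one-arm marginal.\<close>

lemma expected_subsample_bound:
  fixes M :: "real measure" and v :: real and k :: nat
  assumes prob: "prob_space M" and sets_M: "sets M = sets borel" and S: "S \<subseteq> {0..<k}"
    and th: "0 < th" and a: "measure M {..1 - th} \<le> a" and b: "(\<integral>x. gap_cost th x \<partial>M) \<le> b"
    and K: "0 \<le> K" and u: "0 \<le> u"
  defines "N \<equiv> PiM {0..<k} (\<lambda>_. M)"
  defines "F \<equiv> \<lambda>mu. u * of_bool (\<forall>i\<in>S. mu i \<le> 1 - th) + v + K * (\<Sum>i\<in>S. gap_cost th (mu i))"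
  shows "integrable N F" "(\<integral>mu. F mu \<partial>N) \<le> u * a ^ card S + v + K * (real (card S) * b)"
proof -
  interpret M: prob_space M by fact
  interpret product_prob_space "\<lambda>_. M" "{0..<k}" by (intro product_prob_spaceI prob)
  interpret N: prob_space N unfolding N_def by (intro prob_space_PiM prob)
  note sets_M[measurable_cong]
  have finS: "finite S" using S by (rule finite_subset) simp
  have sp: "space M = UNIV" using sets_eq_imp_space_eq[OF sets_M] by simp
  let ?A = "prod_emb {0..<k} (\<lambda>_. M) S (Pi\<^sub>E S (\<lambda>_. {..1 - th}))"
  have A: "?A \<in> sets N" unfolding N_def using S finS by (intro sets_PiM_I) auto
  have A_iff: "of_bool (\<forall>i\<in>S. mu i \<le> 1 - th) = (indicator ?A mu :: real)" if "mu \<in> space N" for mu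
    using that S finS by (auto simp: prod_emb_def N_def space_PiM indicator_def PiE_def Pi_def extensional_def)
  have intA: "integrable N (\<lambda>mu. indicator ?A mu :: real)"
    using A by (intro integrable_real_indicator) (auto simp: N.emeasure_finite less_top[symmetric])
  have comp: "integrable N (\<lambda>mu. gap_cost th (mu i))" "(\<integral>mu. gap_cost th (mu i) \<partial>N) = (\<integral>x. gap_cost th x \<partial>M)"
    if "i \<in> S" for i
  proof -
    have i: "i \<in> {0..<k}" using that S by auto
    have meas: "(\<lambda>mu. mu i) \<in> N \<rightarrow>\<^sub>M M" unfolding N_def using i by measurable
    have distr: "distr N M (\<lambda>mu. mu i) = M" unfolding N_def using PiM_component[OF i] .
    have "integrable M (gap_cost th)"
      using abs_gap_cost_le[OF th] by (intro M.integrable_const_bound[where B = "1 / th\<^sup>2"]) auto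
    then show "integrable N (\<lambda>mu. gap_cost th (mu i))"
      using integrable_distr[OF meas, of "gap_cost th"] distr by simp
    have "(\<integral>x. gap_cost th x \<partial>distr N M (\<lambda>mu. mu i)) = (\<integral>mu. gap_cost th (mu i) \<partial>N)"
      by (intro integral_distr meas) measurable
    then show "(\<integral>mu. gap_cost th (mu i) \<partial>N) = (\<integral>x. gap_cost th x \<partial>M)"
      by (simp add: distr)
  qed
  let ?F = "\<lambda>mu. u * indicator ?A mu + v + K * (\<Sum>i\<in>S. gap_cost th (mu i))"
  have F_eq: "F mu = ?F mu" if "mu \<in> space N" for mu
    unfolding F_def using A_iff[OF that] by simp
  have "integrable N ?F" using intA comp by auto
  then show "integrable N F" by (simp add: F_eq cong: Bochner_Integration.integrable_cong)
  have "(\<integral>mu. F mu \<partial>N) = (\<integral>mu. ?F mu \<partial>N)" by (intro Bochner_Integration.integral_cong F_eq refl)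
  also have "\<dots> = u * measure N ?A + v + K * (\<Sum>i\<in>S. \<integral>x. gap_cost th x \<partial>M)"
    using intA comp A sets.sets_into_space[OF A] by (simp add: N.prob_space Int_absorb1)
  also have "measure N ?A = measure M {..1 - th} ^ card S"
    unfolding N_def using measure_PiM_emb[OF S finS, of "\<lambda>_. {..1 - th}"] by simp
  also have "u * measure M {..1 - th} ^ card S + v + K * (\<Sum>i\<in>S. \<integral>x. gap_cost th x \<partial>M)
      \<le> u * a ^ card S + v + K * (\<Sum>i\<in>S. b)"
    using K u a b by (intro add_mono mult_left_mono power_mono sum_mono order.refl) auto
  finally show "(\<integral>mu. F mu \<partial>N) \<le> u * a ^ card S + v + K * (real (card S) * b)" by simp
qed

text \<open>Since \<open>sqrt T > 2\<close>, rounding up adds less than half of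
  \<open>sqrt T\<close>. The bound \<open>3 \<le> m\<close> is what the expected pull count asks
  for.\<close>

lemma nat_ceiling_sqrt_bounds:
  assumes "5 \<le> T"
  defines "m \<equiv> nat \<lceil>sqrt (real T)\<rceil>"
  shows "3 \<le> m" "m \<le> T" "sqrt (real T) \<le> real m" "real m \<le> 3 / 2 * sqrt (real T)"
proof -
  have 2: "2 < sqrt (real T)" using assms by (intro real_less_rsqrt) auto
  show "sqrt (real T) \<le> real m" unfolding m_def by linarith
  then show "3 \<le> m" using 2 by linarith
  show m: "real m \<le> 3 / 2 * sqrt (real T)" unfolding m_def using 2 by linarith
  have "3 / 2 * sqrt (real T) \<le> sqrt (real T) * sqrt (real T)" using 2 by (intro mult_right_mono) auto
  with m show "m \<le> T" by simp
qed

theorem theorem3: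
  fixes P :: "real \<Rightarrow> real measure" and \<Gamma> :: "real measure"
    and k T :: nat and c0 C0 :: real
  assumes T: "2 \<le> T"
    and m_le_k: "nat \<lceil>sqrt (real T)\<rceil> \<le> k"
    and fam_prob: "\<And>mu. mu \<in> {0..1} \<Longrightarrow> prob_space (P mu) \<and> sets (P mu) = sets borel"
    and fam_mean: "\<And>mu. mu \<in> {0..1} \<Longrightarrow> integrable (P mu) (\<lambda>z. z) \<and> (\<integral>z. z \<partial>P mu) = mu"
    and fam_subg: "\<And>mu. mu \<in> {0..1} \<Longrightarrow> subgaussian1 (P mu) mu"
    and fam_meas: "P \<in> measurable (restrict_space borel {0..1}) (subprob_algebra borel)"
    and prior_density: "\<exists>g. g \<in> borel_measurable borel \<and> \<Gamma> = density lborel g"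
    and prior_prob: "prob_space \<Gamma>"
    and prior_supp: "measure \<Gamma> {0..1} = 1"
    and reg: "one_regular \<Gamma> c0 C0"
  shows "ss_ucb_BR P \<Gamma> k T (nat \<lceil>sqrt (real T)\<rceil>)
     \<le> 2 + sqrt (real T) * (ln (real T) / c0 + C0 * (ln (real T))^2 / c0^2
          + C0 * (20 + 36 * ln (f_conf T)) * (5 + ln (sqrt (real T) * c0) - ln (ln (real T))))"
proof -
  define m where "m = nat \<lceil>sqrt (real T)\<rceil>"
  define r where "r = sqrt (real T)"
  define L where "L = ln (real T)"
  define lf where "lf = ln (f_conf T)"
  \<comment> \<open>Chosen so that \<open>c0 * th * r = L\<close>: then \<open>m \<ge> r\<close>
    independent arms all miss the top \<open>th\<close> with probability at most
    \<open>exp (- L) = 1 / T\<close>.\<close>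
  define th where "th = L / (c0 * r)"
  define N where "N = PiM {0..<k} (\<lambda>_. \<Gamma>)"
  interpret \<Gamma>: prob_space \<Gamma> by fact
  interpret product_prob_space "\<lambda>_. \<Gamma>" "{0..<k}" by (intro product_prob_spaceI prior_prob)
  interpret N: prob_space N unfolding N_def by (intro prob_space_PiM prior_prob)
  have sets_\<Gamma>: "sets \<Gamma> = sets borel" using prior_density by auto
  then have space_\<Gamma>: "space \<Gamma> = UNIV" using sets_eq_imp_space_eq by fastforce
  have c0: "0 < c0" "c0 \<le> 1" and C0: "1 \<le> C0"
    using reg prior_constants[OF prior_prob prior_supp sets_\<Gamma> reg] by (auto simp: one_regular_def)
  have r: "0 < r" "r * r = real T" using T by (auto simp: r_def)
  have L: "0 < L" using T by (simp add: L_def)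
  have lf: "0 \<le> lf" using f_conf_ge_1[of T] by (simp add: lf_def)
  have th: "0 < th" using L c0 r by (simp add: th_def)
  have m: "0 < m" "m \<le> k" using m_le_k r by (auto simp: m_def r_def)
  have ln_th: "5 + ln (sqrt (real T) * c0) - ln (ln (real T)) = 5 - ln th"
    using L c0 r by (simp add: th_def r_def[symmetric] L_def[symmetric] ln_div ln_mult)
  have Tth: "real T * th = r * L / c0"
    using c0 r by (simp add: th_def r(2)[symmetric])
  \<comment> \<open>The first term of the bound is exactly \<open>T * th\<close>;
    \<open>rest\<close> collects the other two.\<close>
  define rest where "rest = r * (C0 * L\<^sup>2 / c0\<^sup>2 + C0 * (20 + 36 * lf) * (5 - ln th))"
  have rhs: "2 + sqrt (real T) * (ln (real T) / c0 + C0 * (ln (real T))^2 / c0^2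
          + C0 * (20 + 36 * ln (f_conf T)) * (5 + ln (sqrt (real T) * c0) - ln (ln (real T))))
      = 2 + real T * th + rest"
    unfolding ln_th unfolding Tth rest_def r_def[symmetric] L_def[symmetric] lf_def[symmetric] by (simp add: algebra_simps)
  have sq: "C0 * L\<^sup>2 / c0\<^sup>2 = C0 * (real T * th\<^sup>2)"
    using c0 r by (simp add: th_def power_divide power_mult_distrib power2_eq_square r(2)[symmetric])
  have rest: "0 \<le> rest"
  proof -
    have "0 \<le> r * (C0 * (real T * th\<^sup>2 + (20 + 36 * lf) * (5 - ln th)))"
      using f_conf_growth_nonneg[OF T th] r C0 unfolding lf_def by (intro mult_nonneg_nonneg) auto
    then show ?thesis unfolding rest_def sq by (simp add: algebra_simps)
  qed
  have AE_mu: "AE mu in N. \<forall>i<k. mu i \<in> {0..1}"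
  proof -
    have "AE x in \<Gamma>. x \<in> {0..1}"
      using prior_supp by (intro \<Gamma>.AE_prob_1) auto
    then have "AE mu in N. \<forall>i\<in>{0..<k}. mu i \<in> {0..1}"
      unfolding N_def by (intro AE_finite_allI AE_component) auto
    then show ?thesis by auto
  qed
  txt \<open>No measurability of the regret in \<open>mu\<close> is needed: a non-integrable function has integral \<open>0\<close>.\<close>
  have le: "ss_ucb_BR P \<Gamma> k T m \<le> b"
    if "integrable N B" "(\<integral>mu. B mu \<partial>N) \<le> b" "0 \<le> b"
      "\<And>mu. (\<And>i. i < k \<Longrightarrow> mu i \<in> {0..1}) \<Longrightarrow> ss_ucb_regret P k T m mu \<le> B mu" for B b
  proof (cases "integrable N (ss_ucb_regret P k T m)")
    case True
    have "(\<integral>mu. ss_ucb_regret P k T m mu \<partial>N) \<le> (\<integral>mu. B mu \<partial>N)"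
      using True that(1) AE_mu by (intro integral_mono_AE) (auto elim!: eventually_mono intro!: that(4))
    then show ?thesis using that(2) by (simp add: ss_ucb_BR_def N_def)
  next
    case False
    then show ?thesis using that(3) by (simp add: ss_ucb_BR_def N_def not_integrable_integral_eq)
  qed
  have le_T: "ss_ucb_BR P \<Gamma> k T m \<le> real T"
    using ss_ucb_regret_le_T[OF fam_prob fam_subg _ m] by (intro le[of "\<lambda>_. real T"]) (auto simp: N.prob_space)
  have "ss_ucb_BR P \<Gamma> k T m \<le> 2 + real T * th + rest"
  \<comment> \<open>Here the trivial bound \<open>T\<close> is at most \<open>2\<close> or at most
    \<open>T * th\<close>, and \<open>rest\<close> is nonnegative.\<close>
  proof (cases "T = 2 \<or> 1 \<le> th")
    case True
    moreover have "real T * 1 \<le> real T * th" if "1 \<le> th" using that by (intro mult_left_mono) auto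
    moreover have "0 \<le> real T * th" using th by simp
    ultimately show ?thesis using le_T rest by auto
  next
    case False
    then have T3: "3 \<le> T" and th1: "th < 1" using T by auto
    have L1: "1 \<le> L" using ln_ge_1[of "real T"] T3 by (simp add: L_def)
    have ln_th: "ln th < 0" using th th1 by simp
    \<comment> \<open>The second term pays for another \<open>T * th\<close>, using
      \<open>1 \<le> L\<close>. With the first term this gives a budget of
      \<open>2 * T * th\<close>, which is at least \<open>T\<close> as soon as
      \<open>1 \<le> 2 * th\<close>.\<close>
    have second: "real T * th \<le> r * (C0 * L\<^sup>2 / c0\<^sup>2)"
    proof -
      have "1 * 1 \<le> C0 * L" using C0 L1 by (intro mult_mono) auto
      then have "c0 \<le> C0 * L" using c0 by simp
      then have "1 \<le> C0 * L / c0" using c0 by (simp add: field_simps)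
      then have "r * L / c0 * 1 \<le> r * L / c0 * (C0 * L / c0)"
        using r L c0 by (intro mult_left_mono) auto
      then show ?thesis unfolding Tth by (simp add: power2_eq_square mult_ac)
    qed
    have third: "0 \<le> r * (C0 * (20 + 36 * lf) * (5 - ln th))"
      using r C0 lf ln_th by (intro mult_nonneg_nonneg) auto
    show ?thesis
    proof (cases "1 \<le> 2 * th")
      case True
      then have "real T * 1 \<le> real T * (2 * th)" by (intro mult_left_mono) auto
      then show ?thesis using le_T second third by (simp add: rest_def distrib_left)
    next
      case False
      \<comment> \<open>For \<open>T \<le> 4\<close> one has
        \<open>c0 * r \<le> 2 \<le> 2 * L\<close>, that is \<open>1 \<le> 2 * th\<close>, which is
        excluded here.\<close>
      have T5: "5 \<le> T"
      proof (rule ccontr)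
        assume "\<not> 5 \<le> T"
        then have "r \<le> 2" unfolding r_def by (intro real_le_lsqrt) auto
        then have "c0 * r \<le> 1 * 2" using c0 r by (intro mult_mono) auto
        then have "c0 * r \<le> 2 * L" using L1 by simp
        then show False using False c0 r by (simp add: th_def field_simps)
      qed
      note mb = nat_ceiling_sqrt_bounds[OF T5, folded m_def r_def]
      define K where "K = 20 + 18 * lf"
      define G where "G = C0 * (5 - ln th)"
      have K: "0 \<le> K" using lf by (simp add: K_def)
      have G: "0 \<le> G" using C0 ln_th by (simp add: G_def)
      let ?fam = "{S. S \<subseteq> {0..<k} \<and> card S = m}"
      let ?B = "\<lambda>S mu. real T * of_bool (\<forall>i\<in>S. mu i \<le> 1 - th) + 2 * th * real T + K * (\<Sum>i\<in>S. gap_cost th (mu i))"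
      have lower: "measure \<Gamma> {..1 - th} \<le> 1 - c0 * th"
      proof -
        have "measure \<Gamma> {..1 - th} = 1 - measure \<Gamma> (space \<Gamma> - {..1 - th})"
          using \<Gamma>.prob_compl[of "{..1 - th}"] sets_\<Gamma> by simp
        also have "space \<Gamma> - {..1 - th} = {x. 1 - th < x}" using space_\<Gamma> by auto
        also have "c0 * th \<le> measure \<Gamma> {x. 1 - th < x}"
          using reg th th1 by (auto simp: one_regular_def)
        then have "1 - measure \<Gamma> {x. 1 - th < x} \<le> 1 - c0 * th" by simp
        finally show ?thesis .
      qed
      have cost: "(\<integral>x. gap_cost th x \<partial>\<Gamma>) \<le> G"
        unfolding G_def using False C0 th reg
        by (intro integral_gap_cost_le prior_prob sets_\<Gamma>) (auto simp: one_regular_def)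
      define b where "b = real T * (1 - c0 * th) ^ m + 2 * th * real T + K * (real m * G)"
      have S: "integrable N (?B S)" "(\<integral>mu. ?B S mu \<partial>N) \<le> b" if "S \<in> ?fam" for S
        using expected_subsample_bound[OF prior_prob sets_\<Gamma> _ th lower cost K, of S k "real T" "2 * th * real T"] that
        unfolding N_def b_def by auto
      have card: "card ?fam = k choose m" using n_subsets[of "{0..<k}" m] by simp
      have pos: "0 < real (k choose m)" using m by (simp add: zero_less_binomial_iff)
      have "(1 - c0 * th) ^ m \<le> exp (- (c0 * th)) ^ m"
        using exp_ge_add_one_self[of "- (c0 * th)"] c0 th th1 mult_le_one[of c0 th] by (intro power_mono) auto
      also have "\<dots> = exp (- (real m * L / r))"
        using c0 r by (simp add: exp_of_nat_mult[symmetric] th_def)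
      also have "\<dots> \<le> exp (- L)"
      proof -
        have "r * L \<le> real m * L" using mb(3) L by (intro mult_right_mono) auto
        then show ?thesis using r by (simp add: field_simps)
      qed
      also have "\<dots> = 1 / real T" using T by (simp add: L_def exp_minus divide_inverse)
      finally have first: "real T * (1 - c0 * th) ^ m \<le> 1"
        using T by (simp add: field_simps)
      \<comment> \<open>Rounding \<open>m\<close> up costs a factor \<open>3 / 2\<close>, and
        \<open>3 / 2 * (20 + 18 * lf) \<le> 20 + 36 * lf\<close> holds once
        \<open>lf \<ge> 10 / 9\<close>. The bound comes from
        \<open>f_conf T \<ge> 6\<close>.\<close>
      have lf1: "5 / 3 \<le> lf"
      proof -
        have "1 \<le> L\<^sup>2" using L1 by simp
        then have "5 * 1 \<le> real T * L\<^sup>2" using T5 by (intro mult_mono) auto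
        then have "ln 6 \<le> lf" unfolding lf_def by (subst ln_le_cancel_iff) (auto simp: f_conf_def L_def)
        moreover have "ln 6 = ln 2 + ln (3::real)" using ln_mult[of 2 "3::real"] by simp
        ultimately show ?thesis using ln2_ge_two_thirds ln_ge_1[of 3] by simp
      qed
      have "K * real m \<le> K * (3 / 2 * r)" using K mb(4) by (intro mult_left_mono) auto
      also have "\<dots> \<le> (20 + 36 * lf) * r"
      proof -
        have "K * (3 / 2) \<le> 20 + 36 * lf" using lf1 by (simp add: K_def)
        from mult_right_mono[OF this, of r] show ?thesis using r by (simp add: mult_ac)
      qed
      finally have "K * real m * G \<le> (20 + 36 * lf) * r * G" using G by (rule mult_right_mono)
      \<comment> \<open>Missing all good arms costs at most \<open>1\<close>, near arms use the
        budget \<open>2 * T * th\<close> of the first two terms, and far arms fit into the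
        third.\<close>
      then have b_le: "b \<le> 2 + real T * th + rest"
        using first second by (simp add: b_def rest_def G_def algebra_simps)
      show ?thesis
      proof (rule order.trans[OF le b_le])
        show "integrable N (\<lambda>mu. (\<Sum>S\<in>?fam. ?B S mu) / real (k choose m))"
          using S by (intro integrable_divide_zero Bochner_Integration.integrable_sum) auto
        have "(\<integral>mu. (\<Sum>S\<in>?fam. ?B S mu) / real (k choose m) \<partial>N)
            = (\<Sum>S\<in>?fam. \<integral>mu. ?B S mu \<partial>N) / real (k choose m)"
          using S by simp
        also have "\<dots> \<le> (\<Sum>S\<in>?fam. b) / real (k choose m)"
          using S pos by (intro divide_right_mono sum_mono) auto
        also have "\<dots> = b" using pos card by simp
        finally show "(\<integral>mu. (\<Sum>S\<in>?fam. ?B S mu) / real (k choose m) \<partial>N) \<le> b" .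
        show "0 \<le> b"
          unfolding b_def using K G th th1 c0 mult_le_one[of c0 th] by (intro add_nonneg_nonneg mult_nonneg_nonneg) auto
        show "ss_ucb_regret P k T m mu \<le> (\<Sum>S\<in>?fam. ?B S mu) / real (k choose m)"
          if "\<And>i. i < k \<Longrightarrow> mu i \<in> {0..1}" for mu
          using ss_ucb_regret_le[OF fam_prob fam_subg that mb(1) m(2) mb(2) th]
          unfolding K_def lf_def by simp
      qed
    qed
  qed
  then show ?thesis unfolding rhs m_def .
qed

end
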